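(* Let $(\Gamma,L)$ be a periodic graph and let $U\subset V_\Gamma$ be a finite subset. Then the function $\mathbb Z_{\ge0}\to\mathbb Z_{\ge0}$, $i\mapsto\#\{y\in V_\Gamma:\min_{x\in U}d_\Gamma(x,y)\le i\}$, is of quasi-polynomial type.
   Context: A graph is a directed graph (loops/multiple edges allowed) with source/target maps and edge weights in $\mathbb Z_{>0}$; $d_\Gamma(x,y)$ is the minimum total weight of a walk from $x$ to $y$ ($\infty$ if none). A periodic graph $(\Gamma,L)$ consists of a graph $\Gamma$ and a free abelian group $L\cong\mathbb Z^n$ acting freely on vertices and edges with finitely many orbits on each, compatibly with source, target and weight. A function $g:\mathbb Z_{\ge0}\to\mathbb C$ is of quasi-polynomial type if there are $M\ge0$, $N\ge1$ and polynomials $Q_0,\dots,Q_{N-1}$ with $g(m)=Q_j(m)$ for all $m>M$ with $m\equiv j\pmod N$. *)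

theory Defs
  imports
    Complex_Main
    "HOL-Library.Extended_Nat"
    "HOL-Computational_Algebra.Polynomial"
    "HOL-Algebra.Group_Action"
    "HOL-Algebra.Elementary_Groups"
    "HOL-Algebra.Product_Groups"
    "Graph_Theory.Shortest_Path"
begin

locale weighted_graph = wf_digraph G
  for G :: "('v, 'e) pre_digraph" (structure) +
  fixes w :: "'e \<Rightarrow> nat"
  assumes weight_pos: "e \<in> arcs G \<Longrightarrow> 0 < w e"

(* An infimum in enat over a nonempty set is attained, so this is the minimum over all
   walks from x to y, and it is \<infinity> if there is none. The AFP distance \<mu> has values in
   ereal; the two agree, see wdist_eq_\<mu> below. *)
definition wdist :: "('v, 'e) pre_digraph \<Rightarrow> ('e \<Rightarrow> nat) \<Rightarrow> 'v \<Rightarrow> 'v \<Rightarrow> enat" where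
  "wdist G w x y = (INF p \<in> {p. pre_digraph.awalk G x p y}. enat (sum_list (map w p)))"

locale free_action = group_action +
  assumes free: "x \<in> E \<Longrightarrow> stabilizer G \<phi> x = {\<one>}"

(* The rank n is allowed to be 0. *)
locale periodic_graph =
  weighted_graph G w +
  L: comm_group L +
  V: free_action L "verts G" \<alpha> +
  E: free_action L "arcs G" \<beta>
  for G :: "('v, 'e) pre_digraph" (structure)
    and w :: "'e \<Rightarrow> nat"
    and L :: "'l monoid"
    and \<alpha> :: "'l \<Rightarrow> 'v \<Rightarrow> 'v"
    and \<beta> :: "'l \<Rightarrow> 'e \<Rightarrow> 'e" +
  assumes free_abelian_fin_rank: "\<exists>n::nat. L \<cong> product_group {..<n} (\<lambda>_. integer_group)"
    and finite_vert_orbits: "finite (orbits L (verts G) \<alpha>)"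
    and finite_arc_orbits: "finite (orbits L (arcs G) \<beta>)"
    and tail_equivariant:
      "\<lbrakk>g \<in> carrier L; e \<in> arcs G\<rbrakk> \<Longrightarrow> tail G (\<beta> g e) = \<alpha> g (tail G e)"
    and head_equivariant:
      "\<lbrakk>g \<in> carrier L; e \<in> arcs G\<rbrakk> \<Longrightarrow> head G (\<beta> g e) = \<alpha> g (head G e)"
    and weight_invariant:
      "\<lbrakk>g \<in> carrier L; e \<in> arcs G\<rbrakk> \<Longrightarrow> w (\<beta> g e) = w e"

definition quasi_polynomial_type :: "(nat \<Rightarrow> complex) \<Rightarrow> bool" where
  "quasi_polynomial_type g \<longleftrightarrow>
     (\<exists>(M::nat) (N::nat) (Q :: nat \<Rightarrow> complex poly). N \<ge> 1 \<and>
        (\<forall>j<N. \<forall>m>M. m mod N = j \<longrightarrow> g m = poly (Q j) (of_nat m)))"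

lemma wdist_attained:
  assumes "pre_digraph.awalk G x p y"
  obtains q where "pre_digraph.awalk G x q y" "wdist G w x y = enat (sum_list (map w q))"
proof -
  let ?S = "(\<lambda>p. enat (sum_list (map w p))) ` {p. pre_digraph.awalk G x p y}"
  have "?S \<noteq> {}" using assms by blast
  then have "Inf ?S \<in> ?S"
    unfolding Inf_enat_def by (auto intro: LeastI)
  then show ?thesis using that unfolding wdist_def by auto
qed

lemma wdist_le_iff:
  "wdist G w x y \<le> enat i \<longleftrightarrow> (\<exists>p. pre_digraph.awalk G x p y \<and> sum_list (map w p) \<le> i)"
proof
  assume le: "wdist G w x y \<le> enat i"
  have "\<exists>p. pre_digraph.awalk G x p y"
  proof (rule ccontr)
    assume "\<nexists>p. pre_digraph.awalk G x p y"
    then have "wdist G w x y = \<infinity>" by (simp add: wdist_def top_enat_def)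
    with le show False by simp
  qed
  then obtain p where "pre_digraph.awalk G x p y" by blast
  then obtain q where "pre_digraph.awalk G x q y" "wdist G w x y = enat (sum_list (map w q))"
    by (rule wdist_attained)
  with le show "\<exists>p. pre_digraph.awalk G x p y \<and> sum_list (map w p) \<le> i" by auto
next
  assume "\<exists>p. pre_digraph.awalk G x p y \<and> sum_list (map w p) \<le> i"
  then obtain p where p: "pre_digraph.awalk G x p y" "sum_list (map w p) \<le> i" by blast
  then have "wdist G w x y \<le> enat (sum_list (map w p))"
    unfolding wdist_def by (intro INF_lower) simp
  also have "\<dots> \<le> enat i" using p by simp
  finally show "wdist G w x y \<le> enat i" .
qed

lemma (in weighted_graph) wdist_eq_\<mu>:
  "\<mu> (\<lambda>e. real (w e)) x y = ereal_of_enat (wdist G w x y)"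
proof (cases "\<exists>p. awalk x p y")
  case False
  then show ?thesis by (simp add: \<mu>_def wdist_def top_enat_def top_ereal_def)
next
  case True
  have cost: "awalk_cost (\<lambda>e. real (w e)) p = real (sum_list (map w p))" for p
    by (induction p) auto
  from True obtain q where q: "awalk x q y" "wdist G w x y = enat (sum_list (map w q))"
    by (auto elim: wdist_attained)
  have "sum_list (map w q) \<le> sum_list (map w p)" if "awalk x p y" for p
    using that q(2) wdist_le_iff[of G w x y "sum_list (map w p)"] by auto
  then have "(INF p\<in>{p. awalk x p y}. ereal (real (sum_list (map w p))))
      = ereal (real (sum_list (map w q)))"
    using q(1) by (intro antisym INF_lower INF_greatest) auto
  then show ?thesis by (simp add: \<mu>_def cost q(2))
qed

context periodic_graph
begin

lemma finite_arcs_from: "finite {e \<in> arcs G. tail G e = x}"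
proof (rule inj_on_finite)
  show "inj_on (orbit L \<beta>) {e \<in> arcs G. tail G e = x}"
  proof (rule inj_onI)
    fix e f
    assume e: "e \<in> {e \<in> arcs G. tail G e = x}" and f: "f \<in> {e \<in> arcs G. tail G e = x}"
      and eq: "orbit L \<beta> e = orbit L \<beta> f"
    have "f \<in> orbit L \<beta> e" using E.orbit_refl f eq by auto
    then obtain g where g: "g \<in> carrier L" "f = \<beta> g e" by (auto simp: orbit_def)
    have "\<alpha> g x = x" using tail_equivariant[OF g(1), of e] e f g(2) by auto
    then have "g \<in> stabilizer L \<alpha> x" using g by (simp add: stabilizer_def)
    moreover have "x \<in> verts G" using e by auto
    ultimately have "g = \<one>\<^bsub>L\<^esub>" using V.free by blast
    then have "f = \<beta> \<one>\<^bsub>L\<^esub> e" using g(2) by simp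
    also have "\<dots> = e" using E.id_eq_one e by (metis (no_types, lifting) mem_Collect_eq restrict_apply)
    finally show "e = f" by simp
  qed
  show "orbit L \<beta> ` {e \<in> arcs G. tail G e = x} \<subseteq> orbits L (arcs G) \<beta>"
    by (auto simp: orbits_def)
qed (rule finite_arc_orbits)

lemma finite_awalks_from: "finite {p. (\<exists>y. awalk x p y) \<and> length p \<le> k}"
proof (induction k arbitrary: x)
  case 0
  have "{p. (\<exists>y. awalk x p y) \<and> length p \<le> 0} \<subseteq> {[]}" by auto
  then show ?case by (rule finite_subset) simp
next
  case (Suc k)
  have "{p. (\<exists>y. awalk x p y) \<and> length p \<le> Suc k} \<subseteq>
      insert [] (\<Union>e\<in>{e \<in> arcs G. tail G e = x}.
        (#) e ` {p. (\<exists>y. awalk (head G e) p y) \<and> length p \<le> k})"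
  proof
    fix p assume "p \<in> {p. (\<exists>y. awalk x p y) \<and> length p \<le> Suc k}"
    then show "p \<in> insert [] (\<Union>e\<in>{e \<in> arcs G. tail G e = x}.
        (#) e ` {p. (\<exists>y. awalk (head G e) p y) \<and> length p \<le> k})"
      by (cases p) (auto simp: awalk_Cons_iff intro!: exI[of _ "hd p"] imageI)
  qed
  then show ?case
    by (rule finite_subset) (use Suc.IH finite_arcs_from in auto)
qed

(* The balls are finite, so that card in the statement really counts them. *)
lemma finite_ball:
  assumes "finite U"
  shows "finite {y \<in> verts G. (INF x\<in>U. wdist G w x y) \<le> enat i}"
proof -
  have len: "length p \<le> sum_list (map w p)" if "set p \<subseteq> arcs G" for p
    using that by (induction p) (use weight_pos in \<open>force+\<close>)
  have "{y \<in> verts G. (INF x\<in>U. wdist G w x y) \<le> enat i} \<subseteq>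
      (\<Union>x\<in>U. awlast x ` {p. (\<exists>y. awalk x p y) \<and> length p \<le> i})"
  proof
    fix y assume y: "y \<in> {y \<in> verts G. (INF x\<in>U. wdist G w x y) \<le> enat i}"
    then have "(INF x\<in>U. wdist G w x y) < enat (Suc i)" by (auto intro: le_less_trans)
    then obtain x where x: "x \<in> U" "wdist G w x y < enat (Suc i)"
      by (auto simp: INF_less_iff)
    then have "wdist G w x y \<le> enat i"
      by (cases "wdist G w x y") auto
    then obtain p where p: "awalk x p y" "sum_list (map w p) \<le> i"
      by (auto simp: wdist_le_iff)
    then have "length p \<le> i" using len[of p] by (auto simp: awalk_def)
    moreover have "y = awlast x p" using p by auto
    ultimately show "y \<in> (\<Union>x\<in>U. awlast x ` {p. (\<exists>y. awalk x p y) \<and> length p \<le> i})"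
      using x p by blast
  qed
  then show ?thesis
    by (rule finite_subset) (use assms finite_awalks_from in auto)
qed

end

end

theory Submission
  imports
    Defs
    "HOL-Library.Multiset_Order"
    "HOL-Library.Product_Plus"
    "HOL-Library.Function_Algebras"
begin

text \<open>
  Give the vertices coordinates in a cancellative commutative monoid on which L acts by
  translations, and record a walk from U by the pair (endpoint, weight). For a set T of
  vertex orbits, consider the walks whose arcs start exactly in the orbits of T. A long walk of
  this kind contains a short cycle modulo L which can be removed without losing an orbit of T;
  conversely, such a cycle can be inserted wherever its orbit is visited, and because L is commutative
  it changes the pair by an amount that does not depend on the place. Hence the pairs (vertex, i) with
  the vertex at distance at most i form a finite union of finitely generated modules
  \<open>B + \<nat>P\<close> with \<open>B\<close>, \<open>P\<close> finite.

  By Dickson's lemma such modules are closed under intersection, so by inclusion-exclusion it suffices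
  to count the elements of degree i in one of them. Choosing for every element the least multiset
  of generators representing it turns this into counting multisets by weight in a downset,
  which is done by induction on the number of generators.
\<close>

subsection \<open>Eventually quasi-polynomial functions\<close>

text \<open>By the binomial theorem the difference of x^(k+1) is (k+1) x^k plus lower powers of x.
  The lower powers have antidifferences by strong induction; subtracting these and dividing by k+1,
  invertible in characteristic 0, gives the result.\<close>

lemma ex_power_antidifference:
  "\<exists>P::'a::field_char_0 poly. \<forall>x. poly P (x + 1) - poly P x = x ^ k"
proof (induction k rule: less_induct)
  case (less k)
  then have "\<forall>j. \<exists>P::'a poly. j < k \<longrightarrow> (\<forall>x. poly P (x + 1) - poly P x = x ^ j)"
    by blast
  from choice[OF this] obtain P :: "nat \<Rightarrow> 'a poly"
    where P: "\<And>j x. j < k \<Longrightarrow> poly (P j) (x + 1) - poly (P j) x = x ^ j"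
    by blast
  define R where "R = smult (1 / of_nat (Suc k))
    (monom 1 (Suc k) - (\<Sum>j<k. smult (of_nat (Suc k choose j)) (P j)))"
  have "poly R (x + 1) - poly R x = x ^ k" for x
  proof -
    have "(x + 1) ^ Suc k = (\<Sum>j\<le>Suc k. of_nat (Suc k choose j) * x ^ j)"
      by (simp only: binomial_ring power_one mult_1_right)
    also have "\<dots> = x ^ Suc k + of_nat (Suc k) * x ^ k + (\<Sum>j<k. of_nat (Suc k choose j) * x ^ j)"
      by (simp add: lessThan_Suc_atMost[symmetric] del: power_Suc)
    also have "(\<Sum>j<k. of_nat (Suc k choose j) * x ^ j)
        = (\<Sum>j<k. of_nat (Suc k choose j) * (poly (P j) (x + 1) - poly (P j) x))"
      by (intro sum.cong) (simp_all add: P)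
    finally have A: "of_nat (Suc k) * x ^ k = (x + 1) ^ Suc k - x ^ Suc k
        - (\<Sum>j<k. of_nat (Suc k choose j) * (poly (P j) (x + 1) - poly (P j) x))"
      by (simp add: algebra_simps del: power_Suc)
    have B: "poly R (x + 1) - poly R x = (1 / of_nat (Suc k)) * ((x + 1) ^ Suc k - x ^ Suc k
        - (\<Sum>j<k. of_nat (Suc k choose j) * (poly (P j) (x + 1) - poly (P j) x)))"
      by (simp add: R_def poly_monom poly_sum right_diff_distrib sum_subtractf
          del: power_Suc of_nat_Suc)
    show ?thesis
      unfolding B A[symmetric] by (simp del: of_nat_Suc)
  qed
  then show ?case by blast
qed

lemma ex_poly_antidifference:
  fixes Q :: "'a::field_char_0 poly"
  shows "\<exists>P. \<forall>x. poly P (x + 1) - poly P x = poly Q x"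
proof -
  obtain P :: "nat \<Rightarrow> 'a poly" where P: "\<And>j x. poly (P j) (x + 1) - poly (P j) x = x ^ j"
    using choice[of "\<lambda>j P. \<forall>x. poly P (x + 1) - poly P x = x ^ j", OF allI[OF ex_power_antidifference]]
    by blast
  have "poly (\<Sum>j\<le>degree Q. smult (coeff Q j) (P j)) (x + 1)
      - poly (\<Sum>j\<le>degree Q. smult (coeff Q j) (P j)) x = poly Q x" for x
    by (simp add: poly_sum sum_subtractf[symmetric] right_diff_distrib[symmetric] P)
      (simp add: poly_altdef)
  then show ?thesis by blast
qed

lemma eventually_poly_if_difference_eventually_poly:
  fixes u :: "nat \<Rightarrow> 'a::field_char_0"
  assumes "\<forall>\<^sub>F k in sequentially. u (Suc k) = u k + poly Q (of_nat k)"
  shows "\<exists>P. \<forall>\<^sub>F k in sequentially. u k = poly P (of_nat k)"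
proof -
  obtain K where K: "\<And>k. k \<ge> K \<Longrightarrow> u (Suc k) = u k + poly Q (of_nat k)"
    using assms by (auto simp: eventually_sequentially)
  obtain P where P: "\<And>x. poly P (x + 1) - poly P x = poly Q x"
    using ex_poly_antidifference by blast
  \<comment> \<open>An antidifference is determined up to a constant; the constant chosen makes both
    sides agree at \<open>K\<close>.\<close>
  have "u k = poly (P + [:u K - poly P (of_nat K):]) (of_nat k)" if "k \<ge> K" for k
    using that
  proof (induction k rule: dec_induct)
    case (step k)
    then show ?case using K[of k] P[of "of_nat k"] by (simp add: algebra_simps)
  qed simp
  then show ?thesis unfolding eventually_sequentially by blast
qed

text \<open>The polynomials are in the index \<open>k\<close> along a progression, not in the
  argument of \<open>f\<close>, and \<open>j\<close> is not restricted to \<open>j < N\<close>.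
  Shifts and refinements of the period then need no reduction modulo \<open>N\<close>.\<close>

definition eventually_quasi_poly :: "(nat \<Rightarrow> 'a::field_char_0) \<Rightarrow> bool" where
  "eventually_quasi_poly f \<longleftrightarrow>
     (\<exists>N>0. \<forall>j. \<exists>P. \<forall>\<^sub>F k in sequentially. f (j + N * k) = poly P (of_nat k))"

lemma eventually_poly_affine_argument:
  fixes f :: "nat \<Rightarrow> 'a::field_char_0"
  assumes "\<exists>P. \<forall>\<^sub>F k in sequentially. f k = poly P (of_nat k)" "c > 0"
  shows "\<exists>P. \<forall>\<^sub>F k in sequentially. f (c * k + d) = poly P (of_nat k)"
proof -
  obtain P K where K: "\<And>k. k \<ge> K \<Longrightarrow> f k = poly P (of_nat k)"
    using assms(1) by (auto simp: eventually_sequentially)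
  have "f (c * k + d) = poly (pcompose P [:of_nat d, of_nat c:]) (of_nat k)" if "k \<ge> K" for k
  proof -
    have "k \<le> c * k" using \<open>c > 0\<close> by simp
    then have "K \<le> c * k + d" using that by linarith
    then show ?thesis by (simp add: K poly_pcompose algebra_simps)
  qed
  then show ?thesis by (auto simp: eventually_sequentially)
qed

lemma eventually_quasi_poly_refine:
  assumes "\<forall>j. \<exists>P. \<forall>\<^sub>F k in sequentially. f (j + N * k) = poly P (of_nat k)" "c > 0"
  shows "\<exists>P. \<forall>\<^sub>F k in sequentially. f (j + (N * c) * k) = poly P (of_nat k :: 'a::field_char_0)"
  using eventually_poly_affine_argument[of "\<lambda>k. f (j + N * k)" c 0] assms
  by (simp add: mult.assoc)

text \<open>The product of the two periods serves as a common period; \<open>h\<close> will be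
  addition or subtraction.\<close>

lemma eventually_quasi_poly_combine:
  fixes f g :: "nat \<Rightarrow> 'a::field_char_0"
  assumes "eventually_quasi_poly f" "eventually_quasi_poly g"
    and "\<And>P Q. \<exists>R. \<forall>x. h (poly P x) (poly Q x) = poly R x"
  shows "eventually_quasi_poly (\<lambda>i. h (f i) (g i))"
proof -
  obtain M where M: "M > 0" "\<forall>j. \<exists>P. \<forall>\<^sub>F k in sequentially. f (j + M * k) = poly P (of_nat k)"
    using assms(1) unfolding eventually_quasi_poly_def by blast
  obtain N where N: "N > 0" "\<forall>j. \<exists>P. \<forall>\<^sub>F k in sequentially. g (j + N * k) = poly P (of_nat k)"
    using assms(2) unfolding eventually_quasi_poly_def by blast
  have "\<exists>R. \<forall>\<^sub>F k in sequentially. h (f (j + (M * N) * k)) (g (j + (M * N) * k)) = poly R (of_nat k)"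
    for j
  proof -
    obtain P where P: "\<forall>\<^sub>F k in sequentially. f (j + (M * N) * k) = poly P (of_nat k)"
      using eventually_quasi_poly_refine[OF M(2) N(1)] by blast
    obtain Q where Q: "\<forall>\<^sub>F k in sequentially. g (j + (M * N) * k) = poly Q (of_nat k)"
      using eventually_quasi_poly_refine[OF N(2) M(1), of j] by (auto simp: mult.commute)
    obtain R where R: "\<forall>x. h (poly P x) (poly Q x) = poly R x" using assms(3) by blast
    show ?thesis
      by (rule exI[of _ R]) (use P Q in eventually_elim, simp add: R)
  qed
  then show ?thesis
    using M(1) N(1) unfolding eventually_quasi_poly_def by (intro exI[of _ "M * N"]) simp
qed

lemma eventually_quasi_poly_add:
  "eventually_quasi_poly f \<Longrightarrow> eventually_quasi_poly g \<Longrightarrow> eventually_quasi_poly (\<lambda>i. f i + g i)"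
  by (rule eventually_quasi_poly_combine[where h = "(+)"]) (simp_all, metis poly_add)

lemma eventually_quasi_poly_diff:
  "eventually_quasi_poly f \<Longrightarrow> eventually_quasi_poly g \<Longrightarrow> eventually_quasi_poly (\<lambda>i. f i - g i)"
  by (rule eventually_quasi_poly_combine[where h = "(-)"]) (simp_all, metis poly_diff)

text \<open>Agreement from \<open>M\<close> on is enough for the later counts, whose formulas hold
  only once natural subtraction no longer truncates.\<close>

lemma eventually_quasi_poly_cong:
  assumes "eventually_quasi_poly f" "\<And>i. i \<ge> M \<Longrightarrow> f i = g i"
  shows "eventually_quasi_poly g"
proof -
  obtain N where N: "N > 0" "\<And>j. \<exists>P. \<forall>\<^sub>F k in sequentially. f (j + N * k) = poly P (of_nat k)"
    using assms(1) unfolding eventually_quasi_poly_def by blast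
  have "\<exists>P. \<forall>\<^sub>F k in sequentially. g (j + N * k) = poly P (of_nat k)" for j
  proof -
    obtain P where P: "\<forall>\<^sub>F k in sequentially. f (j + N * k) = poly P (of_nat k)"
      using N(2) by blast
    have "\<forall>\<^sub>F k in sequentially. g (j + N * k) = poly P (of_nat k)"
      using P eventually_ge_at_top[of M]
    proof eventually_elim
      case (elim k)
      have "k \<le> N * k" using N(1) by simp
      then have "M \<le> j + N * k" using elim(2) by linarith
      then show ?case using elim(1) assms(2) by simp
    qed
    then show ?thesis by blast
  qed
  then show ?thesis using N(1) unfolding eventually_quasi_poly_def by blast
qed

lemma eventually_quasi_poly_zero: "eventually_quasi_poly (\<lambda>_. 0)"
  unfolding eventually_quasi_poly_def by (intro exI[of _ 1] conjI allI exI[of _ 0]) simp_all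

lemma eventually_quasi_poly_shift_up:
  assumes "eventually_quasi_poly f"
  shows "eventually_quasi_poly (\<lambda>i. f (i + s))"
proof -
  obtain N where N: "N > 0" "\<And>j. \<exists>P. \<forall>\<^sub>F k in sequentially. f (j + N * k) = poly P (of_nat k)"
    using assms unfolding eventually_quasi_poly_def by blast
  have "\<exists>P. \<forall>\<^sub>F k in sequentially. f (j + N * k + s) = poly P (of_nat k)" for j
    using N(2)[of "j + s"] by (simp add: ac_simps)
  then show ?thesis using N(1) unfolding eventually_quasi_poly_def by blast
qed

lemma eventually_quasi_poly_shift_down:
  assumes "eventually_quasi_poly f"
  shows "eventually_quasi_poly (\<lambda>i. f (i - s))"
proof -
  obtain N where N: "N > 0" "\<And>j. \<exists>P. \<forall>\<^sub>F k in sequentially. f (j + N * k) = poly P (of_nat k)"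
    using assms unfolding eventually_quasi_poly_def by blast
  have "\<exists>P. \<forall>\<^sub>F k in sequentially. f (j + N * k - s) = poly P (of_nat k)" for j
  proof -
    \<comment> \<open>Since j - s may be negative, the offset is raised by \<open>N * s\<close>,
      which is at least \<open>s\<close>; in return \<open>k\<close> is lowered by
      \<open>s\<close>.\<close>
    obtain P K where P: "\<And>k. k \<ge> K \<Longrightarrow> f ((j + N * s - s) + N * k) = poly P (of_nat k)"
      using N(2)[of "j + N * s - s"] by (auto simp: eventually_sequentially)
    have "f (j + N * k - s) = poly (pcompose P [:- of_nat s, 1:]) (of_nat k)" if "k \<ge> K + s" for k
    proof -
      have "s \<le> N * s" using N(1) by simp
      moreover have "N * k = N * (k - s) + N * s" using that by (simp add: add_mult_distrib2[symmetric])
      ultimately have "j + N * k - s = (j + N * s - s) + N * (k - s)" by linarith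
      then show ?thesis using P[of "k - s"] that by (simp add: poly_pcompose of_nat_diff)
    qed
    then show ?thesis by (auto simp: eventually_sequentially)
  qed
  then show ?thesis using N(1) unfolding eventually_quasi_poly_def by blast
qed

text \<open>Applying the recurrence \<open>N\<close> times moves the argument by
  \<open>N * s\<close> and adds \<open>N\<close> values of \<open>q\<close>, each eventually
  polynomial along progressions of step \<open>N * s\<close>. So \<open>h\<close> has eventually
  polynomial differences along these progressions.\<close>

lemma eventually_quasi_poly_recurrence:
  fixes h q :: "nat \<Rightarrow> 'a::field_char_0"
  assumes "eventually_quasi_poly q" "s > 0" and rec: "\<And>i. h (i + s) = h i + q i"
  shows "eventually_quasi_poly h"
proof -
  obtain N where N: "N > 0" "\<forall>j. \<exists>P. \<forall>\<^sub>F k in sequentially. q (j + N * k) = poly P (of_nat k)"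
    using assms(1) unfolding eventually_quasi_poly_def by blast
  have iter: "h (i + n * s) = h i + (\<Sum>t<n. q (i + t * s))" for i n
    by (induction n) (use rec[of "i + _ * s"] in \<open>auto simp: algebra_simps\<close>)
  have "\<exists>P. \<forall>\<^sub>F k in sequentially. h (j + (N * s) * k) = poly P (of_nat k)" for j
  proof -
    have "\<forall>t. \<exists>P. \<forall>\<^sub>F k in sequentially. q (j + t * s + (N * s) * k) = poly P (of_nat k)"
      using eventually_quasi_poly_refine[OF N(2) \<open>s > 0\<close>] by blast
    from choice[OF this] obtain P where
      P: "\<And>t. \<forall>\<^sub>F k in sequentially. q (j + t * s + (N * s) * k) = poly (P t) (of_nat k)"
      by blast
    have "\<forall>\<^sub>F k in sequentially. \<forall>t\<in>{..<N}. q (j + t * s + (N * s) * k) = poly (P t) (of_nat k)"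
      using P by (intro eventually_ball_finite) auto
    then have "\<forall>\<^sub>F k in sequentially.
        h (j + (N * s) * Suc k) = h (j + (N * s) * k) + poly (\<Sum>t<N. P t) (of_nat k)"
    proof eventually_elim
      case (elim k)
      have "h (j + (N * s) * Suc k) = h (j + (N * s) * k + N * s)" by (simp add: algebra_simps)
      also have "\<dots> = h (j + (N * s) * k) + (\<Sum>t<N. q (j + t * s + (N * s) * k))"
        unfolding iter by (simp add: ac_simps)
      finally show ?case using elim by (simp add: poly_sum)
    qed
    then show ?thesis by (rule eventually_poly_if_difference_eventually_poly)
  qed
  then show ?thesis using N(1) \<open>s > 0\<close> unfolding eventually_quasi_poly_def
    by (intro exI[of _ "N * s"]) simp
qed

lemma quasi_polynomial_type_if_eventually_quasi_poly:
  assumes "eventually_quasi_poly f"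
  shows "quasi_polynomial_type f"
proof -
  obtain N where N: "N > 0" "\<forall>j. \<exists>P. \<forall>\<^sub>F k in sequentially. f (j + N * k) = poly P (of_nat k)"
    using assms unfolding eventually_quasi_poly_def by blast
  then have "\<forall>j. \<exists>PK. \<forall>k\<ge>snd PK. f (j + N * k) = poly (fst PK) (of_nat k)"
    by (simp add: eventually_sequentially)
  from choice[OF this] obtain PK
    where PK: "\<And>j k. k \<ge> snd (PK j) \<Longrightarrow> f (j + N * k) = poly (fst (PK j)) (of_nat k)" by blast
  define K where "K = Max ((snd \<circ> PK) ` {..<N})"
  \<comment> \<open>Substitutes k = (m - j) / N to pass from a polynomial in the index to one in the
    argument. Below, m > N + N K ensures that the index m div N is at least
    \<open>K\<close>.\<close>
  define Q where "Q j = pcompose (fst (PK j)) [:- of_nat j / of_nat N, 1 / of_nat N:]" for j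
  have "f m = poly (Q j) (of_nat m)" if "j < N" "m > N + N * K" "m mod N = j" for j m
  proof -
    define k where "k = m div N"
    have m: "m = j + N * k" by (simp add: k_def that(3)[symmetric])
    have "snd (PK j) \<le> K" unfolding K_def by (rule Max_ge) (use that(1) in auto)
    moreover have "K \<le> k" 
    proof (rule ccontr)
      assume "\<not> K \<le> k"
      then have "N * k \<le> N * K" by simp
      then show False using that(1,2) m by linarith
    qed
    ultimately have "f m = poly (fst (PK j)) (of_nat k)" using PK[of j k] m by simp
    also have "of_nat k = (- of_nat j / of_nat N + of_nat m * (1 / of_nat N) :: complex)"
      using N(1) by (simp add: m field_simps)
    finally show ?thesis by (simp add: Q_def poly_pcompose)
  qed
  then show ?thesis using N(1) unfolding quasi_polynomial_type_def
    by (intro exI[of _ "N + N * K"] exI[of _ N] exI[of _ Q]) auto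
qed

subsection \<open>Dickson's lemma and downsets of multisets\<close>

text \<open>One coordinate at a time: a sequence of naturals has a monotone subsequence, and a
  nonincreasing one is eventually constant. Passing to further subsequences keeps the coordinates
  already treated nondecreasing.\<close>

lemma Dickson_subsequence:
  fixes s :: "nat \<Rightarrow> 'i \<Rightarrow> nat"
  assumes "finite I"
  shows "\<exists>r::nat \<Rightarrow> nat. strict_mono r \<and> (\<forall>i\<in>I. \<forall>m n. m \<le> n \<longrightarrow> s (r m) i \<le> s (r n) i)"
  using assms
proof (induction I rule: finite_induct)
  case empty
  have "strict_mono (id :: nat \<Rightarrow> nat)" by (simp add: strict_mono_def)
  then show ?case by blast
next
  case (insert a I)
  obtain r :: "nat \<Rightarrow> nat" where r: "strict_mono r"
    "\<forall>i\<in>I. \<forall>m n. m \<le> n \<longrightarrow> s (r m) i \<le> s (r n) i"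
    using insert.IH by (elim exE conjE)
  have "\<exists>f::nat \<Rightarrow> nat. strict_mono f \<and> (\<forall>m n. m \<le> n \<longrightarrow> s (r (f m)) a \<le> s (r (f n)) a)"
  proof -
    obtain f where f: "strict_mono f" "monoseq (\<lambda>n. s (r (f n)) a)"
      using seq_monosub[of "\<lambda>n. s (r n) a"] by blast
    show ?thesis
    proof (cases "\<forall>m n. m \<le> n \<longrightarrow> s (r (f m)) a \<le> s (r (f n)) a")
      case False
      then have dec: "\<And>m n. m \<le> n \<Longrightarrow> s (r (f n)) a \<le> s (r (f m)) a"
        using f(2) unfolding monoseq_def by blast
      \<comment> \<open>From an index \<open>n0\<close> where the minimum \<open>v\<close> is
        attained, the nonincreasing sequence stays equal to \<open>v\<close>.\<close>
      define v where "v = (LEAST v. \<exists>n. v = s (r (f n)) a)"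
      obtain n0 where n0: "v = s (r (f n0)) a"
        unfolding v_def using LeastI_ex[of "\<lambda>v. \<exists>n. v = s (r (f n)) a"] by auto
      have "v \<le> s (r (f n)) a" for n unfolding v_def by (rule Least_le) blast
      then have "s (r (f (n0 + n))) a = v" for n
        using dec[of n0 "n0 + n"] n0 by (metis le_add1 le_antisym)
      moreover have "strict_mono (\<lambda>n. f (n0 + n))" using f(1) by (simp add: strict_mono_def)
      ultimately show ?thesis by (intro exI[of _ "\<lambda>n. f (n0 + n)"]) simp
    qed (use f in blast)
  qed
  then obtain f :: "nat \<Rightarrow> nat" where f: "strict_mono f"
    "\<forall>m n. m \<le> n \<longrightarrow> s (r (f m)) a \<le> s (r (f n)) a"
    by (elim exE conjE)
  have "strict_mono (r \<circ> f)" using r(1) f(1) by (simp add: strict_mono_def)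
  moreover have "s ((r \<circ> f) m) i \<le> s ((r \<circ> f) n) i" if "i \<in> insert a I" "m \<le> n" for i m n
    using that r(2) f(2) strict_mono_less_eq[OF f(1)] by auto
  ultimately show ?case by (intro exI[of _ "r \<circ> f"]) blast
qed

text \<open>If no finite subset of \<open>S\<close> works, elements can be picked one after another
  so that none dominates an earlier one, against the nondecreasing subsequence. The map \<phi>
  assigns coordinates, so that multisets and pairs of multisets are covered alike.\<close>

lemma Dickson_finite_basis:
  fixes \<phi> :: "'s \<Rightarrow> 'i \<Rightarrow> nat"
  assumes "finite I"
  shows "\<exists>F. finite F \<and> F \<subseteq> S \<and> (\<forall>s\<in>S. \<exists>f\<in>F. \<forall>i\<in>I. \<phi> f i \<le> \<phi> s i)"
proof (rule ccontr)
  assume no: "\<not> ?thesis"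
  define pick where "pick F = (SOME s. s \<in> S \<and> (\<forall>f\<in>F. \<not> (\<forall>i\<in>I. \<phi> f i \<le> \<phi> s i)))" for F
  have pick: "pick F \<in> S \<and> (\<forall>f\<in>F. \<not> (\<forall>i\<in>I. \<phi> f i \<le> \<phi> (pick F) i))" if "finite F" "F \<subseteq> S" for F
  proof -
    have "\<not> (\<forall>s\<in>S. \<exists>f\<in>F. \<forall>i\<in>I. \<phi> f i \<le> \<phi> s i)"
    proof
      assume "\<forall>s\<in>S. \<exists>f\<in>F. \<forall>i\<in>I. \<phi> f i \<le> \<phi> s i"
      with that have "finite F \<and> F \<subseteq> S \<and> (\<forall>s\<in>S. \<exists>f\<in>F. \<forall>i\<in>I. \<phi> f i \<le> \<phi> s i)" by (intro conjI)
      then have "\<exists>F. finite F \<and> F \<subseteq> S \<and> (\<forall>s\<in>S. \<exists>f\<in>F. \<forall>i\<in>I. \<phi> f i \<le> \<phi> s i)" by (rule exI)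
      with no show False by (rule notE)
    qed
    then have "\<exists>s. s \<in> S \<and> (\<forall>f\<in>F. \<not> (\<forall>i\<in>I. \<phi> f i \<le> \<phi> s i))" by blast
    from someI_ex[OF this] show ?thesis unfolding pick_def .
  qed
  define Fs where "Fs = rec_nat {} (\<lambda>_ F. insert (pick F) F)"
  have Fs: "finite (Fs n) \<and> Fs n \<subseteq> S" for n
    by (induction n) (use pick in \<open>auto simp: Fs_def\<close>)
  have mem: "pick (Fs m) \<in> Fs n" if "m < n" for m n
    using that by (induction n) (auto simp: Fs_def less_Suc_eq)
  obtain r :: "nat \<Rightarrow> nat" where r: "strict_mono r"
    "\<forall>i\<in>I. \<forall>m n. m \<le> n \<longrightarrow> \<phi> (pick (Fs (r m))) i \<le> \<phi> (pick (Fs (r n))) i"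
    using Dickson_subsequence[OF assms, of "\<lambda>n. \<phi> (pick (Fs n))"] by (elim exE conjE)
  have "r 0 < r 1" using r(1) by (simp add: strict_mono_def)
  then have "pick (Fs (r 0)) \<in> Fs (r 1)" by (rule mem)
  then show False using pick[of "Fs (r 1)"] Fs r(2) by fastforce
qed

lemma multiset_finite_basis:
  assumes "finite A" "\<And>c. c \<in> S \<Longrightarrow> set_mset c \<subseteq> A"
  obtains F where "finite F" "F \<subseteq> S" "\<And>c. c \<in> S \<Longrightarrow> \<exists>f\<in>F. f \<subseteq># c"
proof -
  obtain F where F: "finite F" "F \<subseteq> S" "\<And>c. c \<in> S \<Longrightarrow> \<exists>f\<in>F. \<forall>a\<in>A. count f a \<le> count c a"
    using Dickson_finite_basis[OF assms(1), of S count] by blast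
  have sub: "f \<subseteq># c" if "f \<in> F" "c \<in> S" "\<forall>a\<in>A. count f a \<le> count c a" for f c
  proof (rule mset_subset_eqI)
    fix a show "count f a \<le> count c a"
    proof (cases "a \<in> A")
      case False
      then have "a \<notin># f" using that(1) F(2) assms(2)[of f] by blast
      then show ?thesis by (simp add: not_in_iff)
    qed (use that(3) in blast)
  qed
  have "\<exists>f\<in>F. f \<subseteq># c" if "c \<in> S" for c using F(3)[OF that] sub[OF _ that] by blast
  then show ?thesis by (rule that[OF F(1,2)])
qed

text \<open>A pair of multisets is a vector of multiplicities indexed by the disjoint sum
  \<open>A <+> B\<close>, to which Dickson's lemma applies.\<close>

lemma multiset_pair_finite_basis:
  assumes "finite A" "finite B" "\<And>c d. (c, d) \<in> S \<Longrightarrow> set_mset c \<subseteq> A \<and> set_mset d \<subseteq> B"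
  obtains F where "finite F" "F \<subseteq> S"
    "\<And>c d. (c, d) \<in> S \<Longrightarrow> \<exists>(c', d')\<in>F. c' \<subseteq># c \<and> d' \<subseteq># d"
proof -
  obtain F where F: "finite F" "F \<subseteq> S"
    "\<forall>x\<in>S. \<exists>f\<in>F. \<forall>a\<in>A <+> B. case_sum (count (fst f)) (count (snd f)) a
        \<le> case_sum (count (fst x)) (count (snd x)) a"
    using Dickson_finite_basis[OF finite_Plus[OF assms(1,2)],
        of S "\<lambda>x. case_sum (count (fst x)) (count (snd x))"]
    by (elim exE conjE)
  have "\<exists>(c', d')\<in>F. c' \<subseteq># c \<and> d' \<subseteq># d" if cd: "(c, d) \<in> S" for c d
  proof -
    obtain f where f: "f \<in> F" "\<forall>a\<in>A <+> B. case_sum (count (fst f)) (count (snd f)) a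
        \<le> case_sum (count (fst (c, d))) (count (snd (c, d))) a"
      using bspec[OF F(3) cd] by (elim bexE)
    obtain c' d' where eq: "f = (c', d')" by (cases f)
    note f = f[unfolded eq fst_conv snd_conv]
    have sub: "set_mset c' \<subseteq> A" "set_mset d' \<subseteq> B" using assms(3) F(2) f(1) by blast+
    have "count c' a \<le> count c a" for a
    proof (cases "a \<in> A")
      case True
      then show ?thesis using f(2)[rule_format, OF InlI] by simp
    next
      case False
      then have "a \<notin># c'" using sub(1) by blast
      then show ?thesis by (simp add: not_in_iff)
    qed
    moreover have "count d' a \<le> count d a" for a
    proof (cases "a \<in> B")
      case True
      then show ?thesis using f(2)[rule_format, OF InrI] by simp
    next
      case False
      then have "a \<notin># d'" using sub(2) by blast
      then show ?thesis by (simp add: not_in_iff)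
    qed
    ultimately show ?thesis using f(1) by (auto intro!: bexI[of _ "(c', d')"] mset_subset_eqI)
  qed
  then show ?thesis by (rule that[OF F(1,2)])
qed

section \<open>Counting the multisets of a downset by weight\<close>

lemma finite_multisets_of_weight:
  assumes "finite A" "\<And>a. a \<in> A \<Longrightarrow> 0 < (w a :: nat)"
  shows "finite {c. set_mset c \<subseteq> A \<and> (\<Sum>a\<in>#c. w a) = i}"
proof (rule finite_subset)
  have "size c \<le> (\<Sum>a\<in>#c. w a)" if "set_mset c \<subseteq> A" for c
    using that
  proof (induction c)
    case (add x c)
    then show ?case using assms(2)[of x] by simp
  qed simp
  then show "{c. set_mset c \<subseteq> A \<and> (\<Sum>a\<in>#c. w a) = i} \<subseteq> (\<Union>n\<le>i. {c. set_mset c \<subseteq> A \<and> size c = n})"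
    by auto
  show "finite (\<Union>n\<le>i. {c. set_mset c \<subseteq> A \<and> size c = n})"
    using finite_multisets_of_size[OF assms(1)] by (auto simp: multisets_of_size_def)
qed

text \<open>By Dickson's lemma the multisets over \<open>A\<close> that are missing from some
  \<open>D t\<close> all lie above finitely many of them. Once these finitely many are missing,
  downward closure excludes all the others, so nothing is lost afterwards.\<close>

lemma antimono_downsets_stabilize:
  fixes D :: "nat \<Rightarrow> 'a multiset set"
  assumes "finite A" "\<And>t c. c \<in> D t \<Longrightarrow> set_mset c \<subseteq> A"
    and down: "\<And>t c d. d \<in> D t \<Longrightarrow> c \<subseteq># d \<Longrightarrow> c \<in> D t"
    and anti: "\<And>s t. s \<le> t \<Longrightarrow> D t \<subseteq> D s"
  obtains t0 where "\<And>t. t \<ge> t0 \<Longrightarrow> D t = D t0"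
proof -
  obtain F where F: "finite F" "F \<subseteq> {c. set_mset c \<subseteq> A \<and> (\<exists>t. c \<notin> D t)}"
    "\<And>c. c \<in> {c. set_mset c \<subseteq> A \<and> (\<exists>t. c \<notin> D t)} \<Longrightarrow> \<exists>f\<in>F. f \<subseteq># c"
    by (rule multiset_finite_basis[OF assms(1), of "{c. set_mset c \<subseteq> A \<and> (\<exists>t. c \<notin> D t)}"]) auto
  have "\<forall>f\<in>F. \<exists>t. f \<notin> D t" using F(2) by blast
  from bchoice[OF this] obtain T where T: "\<And>f. f \<in> F \<Longrightarrow> f \<notin> D (T f)" by blast
  define t0 where "t0 = Max (insert 0 (T ` F))"
  have t0: "f \<notin> D t0" if "f \<in> F" for f
    using T[OF that] anti[of "T f" t0] that F(1) by (auto simp: t0_def)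
  have "D t = D t0" if "t \<ge> t0" for t
  proof
    show "D t0 \<subseteq> D t"
    proof (rule ccontr)
      assume "\<not> D t0 \<subseteq> D t"
      then obtain c where c: "c \<in> D t0" "c \<notin> D t" by blast
      then obtain f where "f \<in> F" "f \<subseteq># c" using F(3) assms(2) by blast
      then show False using t0 down c(1) by blast
    qed
  qed (rule anti[OF that])
  then show ?thesis using that by blast
qed

text \<open>Induction on the number of letters. Slicing \<open>D\<close> by the multiplicity of a
  new letter \<open>a\<close> gives decreasing downsets over \<open>A\<close>, which are constant
  from some \<open>t0\<close> on. From there on, adding one more \<open>a\<close> is a bijection,
  which yields a recurrence of step \<open>w a\<close>; the finitely many slices below
  \<open>t0\<close> are added one at a time.\<close>

lemma eventually_quasi_poly_downset_count:
  fixes w :: "'a \<Rightarrow> nat"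
  assumes "finite A" "\<And>a. a \<in> A \<Longrightarrow> 0 < w a"
    and "\<And>c. c \<in> D \<Longrightarrow> set_mset c \<subseteq> A"
    and "\<And>c d. d \<in> D \<Longrightarrow> c \<subseteq># d \<Longrightarrow> c \<in> D"
  shows "eventually_quasi_poly
    (\<lambda>i. of_nat (card {c \<in> D. (\<Sum>a\<in>#c. w a) = i}) :: 'b::field_char_0)"
  using assms
proof (induction A arbitrary: D rule: finite_induct)
  case empty
  have no: "{c \<in> D. (\<Sum>a\<in>#c. w a) = i} = {}" if "i \<ge> 1" for i
    using empty.prems(2) that by force
  show ?case
    by (rule eventually_quasi_poly_cong[OF eventually_quasi_poly_zero, of 1]) (simp add: no)
next
  case (insert a A)
  let ?wt = "\<lambda>c. \<Sum>a\<in>#c. w a"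
  define sl where "sl t = {c. set_mset c \<subseteq> A \<and> c + replicate_mset t a \<in> D}" for t
  define H where "H t i = {c \<in> D. count c a \<ge> t \<and> ?wt c = i}" for t i
  have fin: "finite {c \<in> D. ?wt c = i}" for i
    by (rule finite_subset[OF _ finite_multisets_of_weight[of "insert a A" w i]])
      (use insert in auto)
  have finH: "finite (H t i)" for t i
    by (rule finite_subset[OF _ fin[of i]]) (auto simp: H_def)
  have sl_down: "c \<in> sl t" if "d \<in> sl t" "c \<subseteq># d" for c d t
  proof -
    have "c + replicate_mset t a \<subseteq># d + replicate_mset t a" using that(2) by simp
    then show ?thesis using that insert.prems(3) set_mset_mono[OF that(2)] by (auto simp: sl_def)
  qed
  have sl_anti: "sl t \<subseteq> sl s" if "s \<le> t" for s t
  proof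
    fix c assume c: "c \<in> sl t"
    have "c + replicate_mset s a \<subseteq># c + replicate_mset t a"
      using that by (auto intro!: mset_subset_eqI)
    then show "c \<in> sl s" using c insert.prems(3) by (auto simp: sl_def)
  qed
  obtain t0 where t0: "\<And>t. t \<ge> t0 \<Longrightarrow> sl t = sl t0"
    by (rule antimono_downsets_stabilize[of A sl, OF insert.hyps(1) _ sl_down sl_anti])
      (auto simp: sl_def)
  have sl_qp: "eventually_quasi_poly (\<lambda>i. of_nat (card {c \<in> sl t. ?wt c = i}) :: 'b)" for t
  proof (rule insert.IH)
    show "set_mset c \<subseteq> A" if "c \<in> sl t" for c using that by (simp add: sl_def)
  qed (use insert.prems(1) sl_down in blast)+
  have split: "card (H t i) = card {c \<in> sl t. ?wt c = i - t * w a} + card (H (Suc t) i)"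
    if "i \<ge> t * w a" for t i
  proof -
    have "bij_betw (\<lambda>c. c + replicate_mset t a) {c \<in> sl t. ?wt c = i - t * w a}
        {c \<in> D. count c a = t \<and> ?wt c = i}"
    proof (rule bij_betwI[of _ _ _ "\<lambda>c. c - replicate_mset t a"])
      show "(\<lambda>c. c + replicate_mset t a) \<in> {c \<in> sl t. ?wt c = i - t * w a}
          \<rightarrow> {c \<in> D. count c a = t \<and> ?wt c = i}"
        using that insert.hyps(2) by (auto simp: sl_def count_eq_zero_iff)
      show "(\<lambda>c. c - replicate_mset t a) \<in> {c \<in> D. count c a = t \<and> ?wt c = i}
          \<rightarrow> {c \<in> sl t. ?wt c = i - t * w a}"
      proof
        fix c assume c: "c \<in> {c \<in> D. count c a = t \<and> ?wt c = i}"
        then have sub: "replicate_mset t a \<subseteq># c" by (auto intro!: mset_subset_eqI)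
        then obtain d where d: "c = d + replicate_mset t a"
          by (metis subset_mset.diff_add)
        moreover have "a \<notin># d" using c d by (auto simp: count_eq_zero_iff)
        moreover have "set_mset d \<subseteq> insert a A" using c d insert.prems(2)[of c] by auto
        ultimately show "c - replicate_mset t a \<in> {c \<in> sl t. ?wt c = i - t * w a}"
          using c by (auto simp: sl_def)
      qed
      show "c + replicate_mset t a - replicate_mset t a = c" for c by simp
      show "c - replicate_mset t a + replicate_mset t a = c"
        if "c \<in> {c \<in> D. count c a = t \<and> ?wt c = i}" for c
        using that by (intro subset_mset.diff_add) (auto intro!: mset_subset_eqI)
    qed
    then have "card {c \<in> sl t. ?wt c = i - t * w a} = card {c \<in> D. count c a = t \<and> ?wt c = i}"
      by (rule bij_betw_same_card)
    moreover have "H t i = {c \<in> D. count c a = t \<and> ?wt c = i} \<union> H (Suc t) i"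
      by (auto simp: H_def)
    moreover have "{c \<in> D. count c a = t \<and> ?wt c = i} \<inter> H (Suc t) i = {}"
      by (auto simp: H_def)
    moreover have "finite {c \<in> D. count c a = t \<and> ?wt c = i}"
      by (rule finite_subset[OF _ fin[of i]]) auto
    ultimately show ?thesis using finH by (metis card_Un_disjoint)
  qed
  \<comment> \<open>This is where stabilization enters: for multiplicities at least
    \<open>t0\<close>, the slices \<open>sl t\<close> and \<open>sl (Suc t)\<close> coincide, so one
    more \<open>a\<close> stays in \<open>D\<close>.\<close>
  have shift: "card (H (Suc t0) (i + w a)) = card (H t0 i)" for i
  proof -
    have mem: "c + {#a#} \<in> D" if "c \<in> D" "count c a \<ge> t0" for c
    proof -
      define t where "t = count c a"
      have "replicate_mset t a \<subseteq># c" by (auto simp: t_def intro!: mset_subset_eqI)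
      then obtain d where d: "c = d + replicate_mset t a" by (metis subset_mset.diff_add)
      then have "count c a = count d a + t" by simp
      then have "a \<notin># d" using t_def by (simp add: not_in_iff)
      moreover have "set_mset d \<subseteq> insert a A" using d insert.prems(2)[OF that(1)] by auto
      ultimately have "d \<in> sl t" using that(1) d by (auto simp: sl_def)
      then have "d \<in> sl (Suc t)" using t0[of t] t0[of "Suc t"] that(2) by (simp add: t_def)
      then show ?thesis using d by (simp add: sl_def)
    qed
    have "bij_betw (\<lambda>c. c + {#a#}) (H t0 i) (H (Suc t0) (i + w a))"
    proof (rule bij_betwI[of _ _ _ "\<lambda>c. c - {#a#}"])
      show "(\<lambda>c. c + {#a#}) \<in> H t0 i \<rightarrow> H (Suc t0) (i + w a)"
        using mem by (auto simp: H_def)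
      show "(\<lambda>c. c - {#a#}) \<in> H (Suc t0) (i + w a) \<rightarrow> H t0 i"
      proof
        fix c assume c: "c \<in> H (Suc t0) (i + w a)"
        then have "Suc t0 \<le> count c a" by (simp add: H_def)
        then have "a \<in># c" by (intro ccontr[of "a \<in># c"]) (simp add: not_in_iff)
        then obtain d where "c = add_mset a d" by (metis insert_DiffM)
        then show "c - {#a#} \<in> H t0 i" using c insert.prems(3)[of c d] by (auto simp: H_def)
      qed
      show "c - {#a#} + {#a#} = c" if "c \<in> H (Suc t0) (i + w a)" for c
      proof -
        have "Suc t0 \<le> count c a" using that by (simp add: H_def)
        then have "a \<in># c" by (intro ccontr[of "a \<in># c"]) (simp add: not_in_iff)
        then show ?thesis by simp
      qed
    qed simp
    then show ?thesis by (rule bij_betw_same_card[symmetric])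
  qed
  \<comment> \<open>Descends from the threshold \<open>t0\<close> to 0, where \<open>H 0 i\<close>
    is the whole level of \<open>D\<close>.\<close>
  have "eventually_quasi_poly (\<lambda>i. of_nat (card (H (t0 - n) i)) :: 'b)" for n
  proof (induction n)
    case 0
    \<comment> \<open>The shift by \<open>t0 * w a\<close> lets \<open>split\<close> apply at every
      argument, so that the recurrence holds without exception; it is undone afterwards.\<close>
    have "eventually_quasi_poly (\<lambda>i. of_nat (card (H t0 (i + t0 * w a))) :: 'b)"
    proof (rule eventually_quasi_poly_recurrence)
      show "eventually_quasi_poly (\<lambda>i. of_nat (card {c \<in> sl t0. ?wt c = i + w a}) :: 'b)"
        using eventually_quasi_poly_shift_up[OF sl_qp] .
      show "of_nat (card (H t0 (i + w a + t0 * w a)))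
          = of_nat (card (H t0 (i + t0 * w a))) + (of_nat (card {c \<in> sl t0. ?wt c = i + w a}) :: 'b)" for i
        using split[of t0 "i + w a + t0 * w a"] shift[of "i + t0 * w a"] by (simp add: ac_simps)
    qed (use insert.prems(1) in simp)
    from eventually_quasi_poly_shift_down[OF this, of "t0 * w a"]
    show ?case by (rule eventually_quasi_poly_cong[of _ "t0 * w a"]) simp
  next
    case (Suc n)
    show ?case
    proof (cases "n < t0")
      case True
      then have t: "t0 - n = Suc (t0 - Suc n)" by simp
      show ?thesis
        by (rule eventually_quasi_poly_cong[OF eventually_quasi_poly_add[OF
              eventually_quasi_poly_shift_down[OF sl_qp[of "t0 - Suc n"], of "(t0 - Suc n) * w a"] Suc.IH],
            of "(t0 - Suc n) * w a"])
          (use split[of "t0 - Suc n"] t in simp)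
    qed (use Suc.IH in simp)
  qed
  from this[of t0] show ?case by (simp add: H_def)
qed

subsection \<open>Finitely generated modules over affine monoids\<close>

text \<open>Multisets play the role of vectors of natural coefficients, which makes Dickson's lemma
  available for representations.\<close>

definition nat_span :: "'a::comm_monoid_add set \<Rightarrow> 'a set" where
  "nat_span P = {sum_mset c | c. set_mset c \<subseteq> P}"

lemma sum_mset_in_nat_span: "set_mset c \<subseteq> P \<Longrightarrow> sum_mset c \<in> nat_span P"
  by (auto simp: nat_span_def)

lemma nat_spanE:
  assumes "x \<in> nat_span P"
  obtains c where "set_mset c \<subseteq> P" "x = sum_mset c"
  using assms by (auto simp: nat_span_def)

lemma zero_in_nat_span: "0 \<in> nat_span P"
  using sum_mset_in_nat_span[of "{#}" P] by simp

lemma generator_in_nat_span: "p \<in> P \<Longrightarrow> p \<in> nat_span P"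
  using sum_mset_in_nat_span[of "{#p#}" P] by simp

lemma add_in_nat_span:
  assumes "x \<in> nat_span P" "y \<in> nat_span P"
  shows "x + y \<in> nat_span P"
proof -
  obtain c d where "set_mset c \<subseteq> P" "x = sum_mset c" "set_mset d \<subseteq> P" "y = sum_mset d"
    using assms by (auto elim!: nat_spanE)
  then show ?thesis using sum_mset_in_nat_span[of "c + d" P] by simp
qed

lemma nat_span_subset:
  assumes "P \<subseteq> nat_span Q"
  shows "nat_span P \<subseteq> nat_span Q"
proof
  fix x assume "x \<in> nat_span P"
  then obtain c where c: "set_mset c \<subseteq> P" "x = sum_mset c" by (rule nat_spanE)
  have "sum_mset c \<in> nat_span Q"
    using c(1)
  proof (induction c)
    case (add p c)
    then show ?case using assms by (auto intro: add_in_nat_span)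
  qed (simp add: zero_in_nat_span)
  then show "x \<in> nat_span Q" using c(2) by simp
qed

text \<open>The module generated by \<open>B\<close> over the monoid \<open>nat_span P\<close>,
  inside an ambient monoid; finiteness is imposed in \<open>fg\<close>.\<close>

definition fg_module :: "'a::comm_monoid_add set \<Rightarrow> 'a set \<Rightarrow> 'a set" where
  "fg_module B P = {b + x | b x. b \<in> B \<and> x \<in> nat_span P}"

lemma fg_moduleI: "b \<in> B \<Longrightarrow> x \<in> nat_span P \<Longrightarrow> b + x \<in> fg_module B P"
  by (auto simp: fg_module_def)

lemma fg_module_add:
  assumes "x \<in> fg_module B P" "y \<in> nat_span P"
  shows "x + y \<in> fg_module B P"
proof -
  obtain b z where "b \<in> B" "z \<in> nat_span P" "x = b + z" using assms(1) by (auto simp: fg_module_def)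
  then show ?thesis using fg_moduleI[OF _ add_in_nat_span[OF _ assms(2)], of b B z]
    by (simp add: add.assoc)
qed

lemma fg_module_insert: "fg_module (insert b B) P = fg_module B P \<union> fg_module {b} P"
  by (auto simp: fg_module_def)

section \<open>Counting, intersections and unions of modules in a graded monoid\<close>

text \<open>Cancellation, provided by the type class, allows a common summand to be dropped when
  representations are compared.\<close>

locale graded_monoid =
  fixes deg :: "'a::cancel_comm_monoid_add \<Rightarrow> nat"
  assumes deg_add: "deg (x + y) = deg x + deg y"
begin

lemma deg_zero: "deg 0 = 0"
  using deg_add[of 0 0] by simp

lemma deg_sum_mset: "deg (sum_mset c) = (\<Sum>x\<in>#c. deg x)"
  by (induction c) (simp_all add: deg_zero deg_add)

definition fg :: "'a set \<Rightarrow> bool" where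
  "fg X \<longleftrightarrow> (\<exists>B P. finite B \<and> finite P \<and> (\<forall>p\<in>P. 0 < deg p) \<and> X = fg_module B P)"

lemma finite_fg_level:
  assumes "fg X"
  shows "finite {x \<in> X. deg x = i}"
proof -
  obtain B P where BP: "finite B" "finite P" "\<forall>p\<in>P. 0 < deg p" "X = fg_module B P"
    using assms unfolding fg_def by blast
  have "{x \<in> X. deg x = i} \<subseteq>
      (\<Union>b\<in>B. \<Union>n\<le>i. (\<lambda>c. b + sum_mset c) ` {c. set_mset c \<subseteq> P \<and> (\<Sum>x\<in>#c. deg x) = n})"
  proof
    fix x assume x: "x \<in> {x \<in> X. deg x = i}"
    then obtain b c where "b \<in> B" "set_mset c \<subseteq> P" "x = b + sum_mset c"
      by (auto simp: BP(4) fg_module_def nat_span_def)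
    moreover from this x have "(\<Sum>x\<in>#c. deg x) \<le> i" by (simp add: deg_add deg_sum_mset)
    ultimately show "x \<in> (\<Union>b\<in>B. \<Union>n\<le>i. (\<lambda>c. b + sum_mset c) `
        {c. set_mset c \<subseteq> P \<and> (\<Sum>x\<in>#c. deg x) = n})" by blast
  qed
  then show ?thesis
    by (rule finite_subset) (use BP(1,3) finite_multisets_of_weight[OF BP(2), of deg] in auto)
qed

text \<open>Each element is counted through its least representation as a sum of generators, for an
  order of multisets that is compatible with addition. Sub-multisets of least representations
  are least, so these form a downset.\<close>

lemma eventually_quasi_poly_fg_module_count:
  assumes "finite B" "finite P" "\<forall>p\<in>P. 0 < deg p"
  shows "eventually_quasi_poly
    (\<lambda>i. of_nat (card {x \<in> fg_module B P. deg x = i}) :: 'b::field_char_0)"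
  using assms(1)
proof (induction B rule: finite_induct)
  case empty
  have "fg_module {} P = {}" by (simp add: fg_module_def)
  then show ?case by (simp add: eventually_quasi_poly_zero)
next
  case (insert b B)
  \<comment> \<open>Numbering the generators transports multisets over \<open>P\<close> to multisets
    of naturals, whose order is total, well-founded and compatible with addition.\<close>
  obtain idx :: "'a \<Rightarrow> nat" where idx: "inj_on idx P"
    using finite_imp_inj_to_nat_seg[OF assms(2)] by blast
  define key where "key = (\<lambda>c. image_mset idx c)"
  \<comment> \<open>Only elements of the new translate that are not already in
    \<open>fg_module B P\<close> are to be counted, each through its representation of least
    key.\<close>
  define D where "D = {c. set_mset c \<subseteq> P \<and> b + sum_mset c \<notin> fg_module B P \<and>
    (\<forall>d. set_mset d \<subseteq> P \<longrightarrow> sum_mset d = sum_mset c \<longrightarrow> key c \<le> key d)}"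
  have key_inj: "c = d" if "set_mset c \<subseteq> P" "set_mset d \<subseteq> P" "key c = key d" for c d
  proof -
    have "image_mset (inv_into P idx) (key e) = e" if "set_mset e \<subseteq> P" for e
    proof -
      have "image_mset (inv_into P idx) (key e) = image_mset (\<lambda>x. inv_into P idx (idx x)) e"
        by (simp add: key_def image_mset.compositionality comp_def)
      also have "\<dots> = image_mset (\<lambda>x. x) e"
        by (rule image_mset_cong) (use that idx in \<open>auto intro: inv_into_f_f\<close>)
      finally show ?thesis by simp
    qed
    then show ?thesis using that by metis
  qed
  \<comment> \<open>Both conditions pass to sub-multisets: adding the complement \<open>e\<close>
    does not lead out of \<open>fg_module B P\<close>, and comparing keys after adding
    \<open>e\<close> is the same as comparing them before.\<close>
  have D_down: "c \<in> D" if d: "d \<in> D" and "c \<subseteq># d" for c d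
  proof -
    obtain e where e: "d = c + e" using \<open>c \<subseteq># d\<close> by (metis subset_mset.le_iff_add)
    then have P: "set_mset c \<subseteq> P" "set_mset e \<subseteq> P" using d by (auto simp: D_def)
    have "b + sum_mset c \<notin> fg_module B P"
    proof
      assume "b + sum_mset c \<in> fg_module B P"
      from fg_module_add[OF this sum_mset_in_nat_span[OF P(2)]]
      show False using d e by (simp add: D_def add.assoc)
    qed
    moreover have "key c \<le> key c'" if "set_mset c' \<subseteq> P" "sum_mset c' = sum_mset c" for c'
    proof -
      have "set_mset (c' + e) \<subseteq> P" "sum_mset (c' + e) = sum_mset d" using that P e by auto
      then have "key d \<le> key (c' + e)" using d unfolding D_def by blast
      then show ?thesis by (simp add: e key_def)
    qed
    ultimately show ?thesis using P(1) by (simp add: D_def)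
  qed
  have D_qp: "eventually_quasi_poly (\<lambda>i. of_nat (card {c \<in> D. (\<Sum>x\<in>#c. deg x) = i}) :: 'b)"
  proof (rule eventually_quasi_poly_downset_count[OF assms(2) _ _ D_down])
    show "set_mset c \<subseteq> P" if "c \<in> D" for c using that by (simp add: D_def)
  qed (use assms(3) in auto)
  have new: "card {c \<in> D. (\<Sum>x\<in>#c. deg x) = i - deg b}
      = card {x \<in> fg_module {b} P - fg_module B P. deg x = i}" if "i \<ge> deg b" for i
  proof (rule bij_betw_same_card)
    show "bij_betw (\<lambda>c. b + sum_mset c) {c \<in> D. (\<Sum>x\<in>#c. deg x) = i - deg b}
        {x \<in> fg_module {b} P - fg_module B P. deg x = i}"
      unfolding bij_betw_def
    proof
      show "inj_on (\<lambda>c. b + sum_mset c) {c \<in> D. (\<Sum>x\<in>#c. deg x) = i - deg b}"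
      proof (rule inj_onI)
        fix c d assume "c \<in> {c \<in> D. (\<Sum>x\<in>#c. deg x) = i - deg b}"
          "d \<in> {c \<in> D. (\<Sum>x\<in>#c. deg x) = i - deg b}" "b + sum_mset c = b + sum_mset d"
        then have "set_mset c \<subseteq> P" "set_mset d \<subseteq> P" "key c \<le> key d" "key d \<le> key c"
          by (auto simp: D_def)
        then show "c = d" using key_inj by force
      qed
      show "(\<lambda>c. b + sum_mset c) ` {c \<in> D. (\<Sum>x\<in>#c. deg x) = i - deg b}
          = {x \<in> fg_module {b} P - fg_module B P. deg x = i}"
      proof (intro equalityI subsetI)
        fix x assume "x \<in> (\<lambda>c. b + sum_mset c) ` {c \<in> D. (\<Sum>x\<in>#c. deg x) = i - deg b}"
        then show "x \<in> {x \<in> fg_module {b} P - fg_module B P. deg x = i}"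
          using that by (auto simp: D_def deg_add deg_sum_mset intro: fg_moduleI sum_mset_in_nat_span)
      next
        fix x assume x: "x \<in> {x \<in> fg_module {b} P - fg_module B P. deg x = i}"
        define R where "R = {c. set_mset c \<subseteq> P \<and> x = b + sum_mset c}"
        define k where "k = (LEAST k. \<exists>c\<in>R. k = key c)"
        have "\<exists>k. \<exists>c\<in>R. k = key c" using x by (auto simp: R_def fg_module_def nat_span_def)
        from LeastI_ex[OF this] obtain c where c: "c \<in> R" "k = key c" unfolding k_def by blast
        have "k \<le> key d" if "d \<in> R" for d unfolding k_def using that by (intro Least_le) blast
        then have "c \<in> D" using c x by (auto simp: D_def R_def)
        moreover have "(\<Sum>x\<in>#c. deg x) = i - deg b"
          using c(1) x by (auto simp: R_def deg_add deg_sum_mset)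
        ultimately show "x \<in> (\<lambda>c. b + sum_mset c) ` {c \<in> D. (\<Sum>x\<in>#c. deg x) = i - deg b}"
          using c(1) by (auto simp: R_def)
      qed
    qed
  qed
  have fin: "finite {x \<in> fg_module (insert b B) P. deg x = i}" for i
    by (rule finite_fg_level) (use insert.hyps assms(2,3) in \<open>auto simp: fg_def\<close>)
  have split: "card {x \<in> fg_module (insert b B) P. deg x = i} = card {x \<in> fg_module B P. deg x = i}
      + card {x \<in> fg_module {b} P - fg_module B P. deg x = i}" for i
  proof -
    have eq: "{x \<in> fg_module (insert b B) P. deg x = i} = {x \<in> fg_module B P. deg x = i}
        \<union> {x \<in> fg_module {b} P - fg_module B P. deg x = i}"
      unfolding fg_module_insert[of b B] by blast
    show ?thesis using fin[of i] unfolding eq by (subst card_Un_disjoint) auto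
  qed
  show ?case
    by (rule eventually_quasi_poly_cong[OF eventually_quasi_poly_add[OF insert.IH
          eventually_quasi_poly_shift_down[OF D_qp, of "deg b"]], of "deg b"])
      (simp add: split new)
qed

lemma eventually_quasi_poly_fg_count:
  "fg X \<Longrightarrow> eventually_quasi_poly (\<lambda>i. of_nat (card {x \<in> X. deg x = i}) :: 'b::field_char_0)"
  unfolding fg_def using eventually_quasi_poly_fg_module_count by blast

text \<open>A common element is a solution (c, d) of a + sum c = b + sum d. The solutions lie above
  finitely many minimal ones, and by cancellation the remainder solves sum c = sum d. The
  homogeneous solutions are sums of finitely many minimal nonzero ones. The former give the
  generators \<open>C\<close>, the latter the monoid generators \<open>S\<close>.\<close>

lemma fg_Int:
  assumes "fg X" "fg Y"
  shows "fg (X \<inter> Y)"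
proof -
  obtain A P where AP: "finite A" "finite P" "\<forall>p\<in>P. 0 < deg p" "X = fg_module A P"
    using assms(1) unfolding fg_def by blast
  obtain B Q where BQ: "finite B" "finite Q" "\<forall>p\<in>Q. 0 < deg p" "Y = fg_module B Q"
    using assms(2) unfolding fg_def by blast
  define K where "K = {(c, d). set_mset c \<subseteq> P \<and> set_mset d \<subseteq> Q \<and> sum_mset c = sum_mset d}"
  \<comment> \<open>The zero solution is removed because it lies below every other one and would be
    a useless basis.\<close>
  obtain F where F: "finite F" "F \<subseteq> K - {({#}, {#})}"
    "\<And>c d. (c, d) \<in> K - {({#}, {#})} \<Longrightarrow> \<exists>(c', d')\<in>F. c' \<subseteq># c \<and> d' \<subseteq># d"
    by (rule multiset_pair_finite_basis[OF AP(2) BQ(2), of "K - {({#}, {#})}"]) (auto simp: K_def)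
  define S where "S = (\<lambda>(c, d). sum_mset c) ` F"
  have K_span: "sum_mset c \<in> nat_span S" if "(c, d) \<in> K" for c d
    using that
  \<comment> \<open>Subtracting a nonzero basic solution leaves, by cancellation, a homogeneous
    solution of smaller total size.\<close>
  proof (induction "size c + size d" arbitrary: c d rule: less_induct)
    case less
    show ?case
    proof (cases "(c, d) = ({#}, {#})")
      case False
      then obtain c' d' where f: "(c', d') \<in> F" "c' \<subseteq># c" "d' \<subseteq># d"
        using F(3)[of c d] less.prems by blast
      obtain u v where uv: "c = c' + u" "d = d' + v"
        using f(2,3) by (metis subset_mset.le_iff_add)
      have f': "(c', d') \<in> K" "(c', d') \<noteq> ({#}, {#})" using f(1) F(2) by auto
      have "(u, v) \<in> K" using less.prems f'(1) unfolding uv by (auto simp: K_def)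
      moreover have "size u + size v < size c + size d"
        using f'(2) unfolding uv by (auto simp: nonempty_has_size)
      ultimately have "sum_mset u \<in> nat_span S" by (rule less.hyps[rotated])
      moreover have "sum_mset c' \<in> nat_span S"
        using f(1) by (intro generator_in_nat_span) (auto simp: S_def)
      ultimately show ?thesis by (simp add: uv add_in_nat_span)
    qed (simp add: zero_in_nat_span)
  qed
  define E where "E a b = {(c, d). set_mset c \<subseteq> P \<and> set_mset d \<subseteq> Q \<and> a + sum_mset c = b + sum_mset d}"
    for a b
  have "\<forall>ab. \<exists>F. finite F \<and> F \<subseteq> E (fst ab) (snd ab) \<and>
      (\<forall>c d. (c, d) \<in> E (fst ab) (snd ab) \<longrightarrow> (\<exists>(c', d')\<in>F. c' \<subseteq># c \<and> d' \<subseteq># d))"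
  proof
    fix ab
    obtain F where "finite F" "F \<subseteq> E (fst ab) (snd ab)"
      "\<And>c d. (c, d) \<in> E (fst ab) (snd ab) \<Longrightarrow> \<exists>(c', d')\<in>F. c' \<subseteq># c \<and> d' \<subseteq># d"
      by (rule multiset_pair_finite_basis[OF AP(2) BQ(2), of "E (fst ab) (snd ab)"]) (auto simp: E_def)
    then show "\<exists>F. finite F \<and> F \<subseteq> E (fst ab) (snd ab) \<and>
      (\<forall>c d. (c, d) \<in> E (fst ab) (snd ab) \<longrightarrow> (\<exists>(c', d')\<in>F. c' \<subseteq># c \<and> d' \<subseteq># d))"
      by (intro exI[of _ F] conjI allI impI)
  qed
  from choice[OF this] obtain H where H: "\<forall>ab. finite (H ab) \<and> H ab \<subseteq> E (fst ab) (snd ab) \<and>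
      (\<forall>c d. (c, d) \<in> E (fst ab) (snd ab) \<longrightarrow> (\<exists>(c', d')\<in>H ab. c' \<subseteq># c \<and> d' \<subseteq># d))" ..
  define C where "C = (\<Union>ab\<in>A \<times> B. (\<lambda>(c, d). fst ab + sum_mset c) ` H ab)"
  have "X \<inter> Y = fg_module C S"
  proof (intro equalityI subsetI)
    fix x assume "x \<in> X \<inter> Y"
    then obtain a b c d where x: "a \<in> A" "b \<in> B" "set_mset c \<subseteq> P" "set_mset d \<subseteq> Q"
        "x = a + sum_mset c" "x = b + sum_mset d"
      unfolding AP(4) BQ(4) fg_module_def nat_span_def by blast
    then have "(c, d) \<in> E (fst (a, b)) (snd (a, b))" by (simp add: E_def)
    then obtain c' d' where f: "(c', d') \<in> H (a, b)" "c' \<subseteq># c" "d' \<subseteq># d"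
      using H by blast
    obtain u v where uv: "c = c' + u" "d = d' + v"
      using f(2,3) by (metis subset_mset.le_iff_add)
    have "(c', d') \<in> E a b" using f(1) H[rule_format, of "(a, b)"] by auto
    then have e: "a + sum_mset c' = b + sum_mset d'" by (simp add: E_def)
    have "(a + sum_mset c') + sum_mset u = (a + sum_mset c') + sum_mset v"
      using x(5,6) unfolding uv by (simp add: e add.assoc[symmetric])
    then have "sum_mset u = sum_mset v" by (rule add_left_imp_eq)
    then have "(u, v) \<in> K" using x(3,4) unfolding uv by (simp add: K_def)
    then have "sum_mset u \<in> nat_span S" by (rule K_span)
    moreover have "a + sum_mset c' \<in> C" using x(1,2) f(1) by (force simp: C_def)
    ultimately show "x \<in> fg_module C S"
      using fg_moduleI[of "a + sum_mset c'" C "sum_mset u" S] x(5) by (simp add: uv add.assoc)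
  next
    fix x assume "x \<in> fg_module C S"
    then obtain y s where y: "y \<in> C" "s \<in> nat_span S" "x = y + s" by (auto simp: fg_module_def)
    have "p \<in> nat_span P \<and> p \<in> nat_span Q" if p: "p \<in> S" for p
    proof -
      obtain c d where "(c, d) \<in> F" "p = sum_mset c" using p by (auto simp: S_def)
      then have "set_mset c \<subseteq> P" "set_mset d \<subseteq> Q" "p = sum_mset c" "p = sum_mset d"
        using F(2) by (auto simp: K_def)
      then show ?thesis using sum_mset_in_nat_span by metis
    qed
    then have s: "s \<in> nat_span P" "s \<in> nat_span Q" using nat_span_subset y(2) by blast+
    obtain a b c d where ab: "a \<in> A" "b \<in> B" "(c, d) \<in> H (a, b)" "y = a + sum_mset c"
      using y(1) by (auto simp: C_def)
    then have "(c, d) \<in> E a b" using H[rule_format, of "(a, b)"] by auto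
    then have e: "set_mset c \<subseteq> P" "set_mset d \<subseteq> Q" "a + sum_mset c = b + sum_mset d"
      by (simp_all add: E_def)
    have "y \<in> X" unfolding AP(4) ab(4) by (intro fg_moduleI ab(1) sum_mset_in_nat_span e(1))
    moreover have "y \<in> Y"
      unfolding BQ(4) ab(4) e(3) by (intro fg_moduleI ab(2) sum_mset_in_nat_span e(2))
    ultimately show "x \<in> X \<inter> Y" using y(3) s fg_module_add unfolding AP(4) BQ(4) by blast
  qed
  moreover have "finite C" using AP(1) BQ(1) H by (auto simp: C_def)
  moreover have "finite S" using F(1) by (simp add: S_def)
  moreover have "0 < deg p" if p: "p \<in> S" for p
  proof -
    obtain c d where cd: "(c, d) \<in> F" "p = sum_mset c" using p by (auto simp: S_def)
    then have K: "set_mset c \<subseteq> P" "set_mset d \<subseteq> Q" "p = sum_mset d" "c \<noteq> {#} \<or> d \<noteq> {#}"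
      using F(2) by (auto simp: K_def)
    have pos: "0 < (\<Sum>x\<in>#e. deg x)" if e: "e \<noteq> {#}" "\<And>x. x \<in># e \<Longrightarrow> 0 < deg x" for e
    proof -
      obtain x e' where "e = add_mset x e'" using e(1) by (cases e) auto
      then show ?thesis using e(2)[of x] by simp
    qed
    \<comment> \<open>Either component of the pair may be empty, but not both; since the two sums
      are equal, a nonempty one gives positive degree.\<close>
    show ?thesis
      using K(4)
    proof
      assume "c \<noteq> {#}"
      then show ?thesis using pos[of c] K(1) AP(3) by (auto simp: cd(2) deg_sum_mset)
    next
      assume "d \<noteq> {#}"
      then show ?thesis using pos[of d] K(2) BQ(3) by (auto simp: K(3) deg_sum_mset)
    qed
  qed
  ultimately show ?thesis unfolding fg_def by blast
qed

text \<open>Inclusion-exclusion for one module against the union of the rest. The induction is on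
  the length of the list, because its hypothesis is applied both to the rest and to its
  intersections with \<open>X\<close>.\<close>

lemma eventually_quasi_poly_fg_Union_count:
  assumes "\<And>X. X \<in> set Xs \<Longrightarrow> fg X"
  shows "eventually_quasi_poly (\<lambda>i. of_nat (card {x \<in> \<Union>(set Xs). deg x = i}) :: 'b::field_char_0)"
  using assms
proof (induction "length Xs" arbitrary: Xs)
  case 0
  then show ?case by (simp add: eventually_quasi_poly_zero)
next
  case (Suc n)
  then obtain X Ys where Xs: "Xs = X # Ys" "length Ys = n" by (metis length_Suc_conv)
  let ?c = "\<lambda>X i. card {x \<in> X. deg x = i}"
  have fgs: "fg X" "\<And>Y. Y \<in> set Ys \<Longrightarrow> fg Y" using Suc.prems Xs by auto
  have union: "eventually_quasi_poly (\<lambda>i. of_nat (?c (\<Union>(set Ys)) i) :: 'b)"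
    using Suc.hyps(1) Xs(2) fgs(2) by blast
  have int: "eventually_quasi_poly (\<lambda>i. of_nat (?c (\<Union>(set (map (\<lambda>Y. X \<inter> Y) Ys))) i) :: 'b)"
    by (rule Suc.hyps(1)) (use Xs(2) fgs fg_Int in auto)
  have "?c (\<Union>(set Xs)) i + ?c (\<Union>(set (map (\<lambda>Y. X \<inter> Y) Ys))) i = ?c X i + ?c (\<Union>(set Ys)) i" for i
  proof -
    have f1: "finite {x \<in> X. deg x = i}" using finite_fg_level fgs(1) by blast
    have "{x \<in> \<Union>(set Ys). deg x = i} = (\<Union>Y\<in>set Ys. {x \<in> Y. deg x = i})" by auto
    then have f2: "finite {x \<in> \<Union>(set Ys). deg x = i}" using finite_fg_level fgs(2) by simp
    have "{x \<in> \<Union>(set Xs). deg x = i} = {x \<in> X. deg x = i} \<union> {x \<in> \<Union>(set Ys). deg x = i}"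
      using Xs(1) by auto
    moreover have "{x \<in> \<Union>(set (map (\<lambda>Y. X \<inter> Y) Ys)). deg x = i}
        = {x \<in> X. deg x = i} \<inter> {x \<in> \<Union>(set Ys). deg x = i}" by auto
    ultimately show ?thesis using card_Un_Int[OF f1 f2] by simp
  qed
  note count = this
  have eq: "(of_nat (?c (\<Union>(set Xs)) i) :: 'b)
      = of_nat (?c X i) + of_nat (?c (\<Union>(set Ys)) i) - of_nat (?c (\<Union>(set (map (\<lambda>Y. X \<inter> Y) Ys))) i)" for i
    using arg_cong[OF count[of i], of "of_nat :: nat \<Rightarrow> 'b"]
    unfolding of_nat_add by (simp only: eq_diff_eq)
  show ?case unfolding eq
    by (intro eventually_quasi_poly_diff eventually_quasi_poly_add union int
        eventually_quasi_poly_fg_count fgs(1))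
qed

end

subsection \<open>Walks in periodic graphs\<close>

text \<open>Cut at the letter whose first occurrence comes last; after it nothing new
  appears.\<close>

lemma ex_last_new_element:
  assumes "xs \<noteq> []"
  shows "\<exists>pre z suf. xs = pre @ z # suf \<and> z \<notin> set pre \<and> set suf \<subseteq> insert z (set pre)"
  using assms
proof (induction xs rule: rev_induct)
  case (snoc x xs)
  show ?case
  proof (cases "x \<in> set xs")
    case True
    then have "xs \<noteq> []" by auto
    then obtain pre z suf where "xs = pre @ z # suf" "z \<notin> set pre" "set suf \<subseteq> insert z (set pre)"
      using snoc.IH by blast
    then show ?thesis using True by (intro exI[of _ pre] exI[of _ z] exI[of _ "suf @ [x]"]) auto
  next
    case False
    then show ?thesis by (intro exI[of _ xs] exI[of _ x] exI[of _ "[]"]) auto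
  qed
qed simp

text \<open>Deleting \<open>v # bs\<close> loses no letter of the word. To find it, cut at the last
  new letter. If more than \<open>c\<close> letters follow, two of the next \<open>c + 1\<close>
  agree by pigeonhole, and all letters between them have occurred earlier. Otherwise the cut removes
  at most \<open>c + 1\<close> positions and exactly one letter of the alphabet, so the length bound
  persists for the prefix.\<close>

lemma ex_removable_loop:
  assumes "card (set xs) \<le> c" "length xs > Suc c * card (set xs)"
  shows "\<exists>as v bs ds. xs = as @ (v # bs) @ (v # ds) \<and> set bs \<subseteq> set as \<union> set (v # ds) \<and> length bs \<le> c"
  using assms
proof (induction "length xs" arbitrary: xs rule: less_induct)
  case less
  have "xs \<noteq> []" using less.prems by auto
  then obtain pre z suf where xs: "xs = pre @ z # suf" "z \<notin> set pre" "set suf \<subseteq> insert z (set pre)"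
    using ex_last_new_element by blast
  have set_xs: "set xs = insert z (set pre)" using xs by auto
  then have card: "card (set xs) = Suc (card (set pre))" using xs(2) by simp
  show ?case
  proof (cases "length suf \<le> c")
    case True
    then have "length pre > Suc c * card (set pre)" using less.prems(2) xs(1) card by simp
    moreover have "card (set pre) \<le> c" "length pre < length xs" using less.prems(1) card xs(1) by auto
    ultimately obtain as v bs ds where "pre = as @ (v # bs) @ (v # ds)"
        "set bs \<subseteq> set as \<union> set (v # ds)" "length bs \<le> c"
      using less.hyps by blast
    then show ?thesis using xs(1)
      by (intro exI[of _ as] exI[of _ v] exI[of _ bs] exI[of _ "ds @ z # suf"]) auto
  next
    case False
    let ?ys = "take (Suc c) suf"
    have "card (set ?ys) \<le> card (set xs)"
      by (rule card_mono) (use xs(1) set_take_subset[of "Suc c" suf] in auto)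
    moreover have "length ?ys = Suc c" using False by simp
    ultimately have "\<not> distinct ?ys" using less.prems(1) distinct_card[of ?ys] by linarith
    then obtain as v bs ds where ys: "?ys = as @ [v] @ bs @ [v] @ ds"
      using not_distinct_decomp by blast
    have "length bs \<le> c" using \<open>length ?ys = Suc c\<close> unfolding ys by simp
    moreover have "suf = ?ys @ drop (Suc c) suf" by simp
    then have suf: "suf = as @ (v # bs) @ (v # ds) @ drop (Suc c) suf" unfolding ys by simp
    then have "set bs \<subseteq> set suf" by (metis Un_iff set_append set_subset_Cons subset_iff)
    then have "set bs \<subseteq> insert z (set pre)" using xs(3) by blast
    ultimately show ?thesis using xs(1) suf
      by (intro exI[of _ "pre @ z # as"] exI[of _ v] exI[of _ bs] exI[of _ "ds @ drop (Suc c) suf"]) auto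
  qed
qed

section \<open>The action of the group on vertices and walks\<close>

lemma (in free_action) free_action_cancel:
  assumes "x \<in> E" "g \<in> carrier G" "h \<in> carrier G" "\<phi> g x = \<phi> h x"
  shows "g = h"
proof -
  interpret group G using group_hom group_hom.axioms(1) by auto
  have "\<phi> (inv h \<otimes> g) x = \<phi> (inv h) (\<phi> h x)"
    using assms by (simp add: composition_rule)
  also have "\<dots> = x" using assms orbit_sym_aux by blast
  finally have "inv h \<otimes> g \<in> stabilizer G \<phi> x" using assms by (simp add: stabilizer_def)
  then have "inv h \<otimes> g = \<one>" using free[OF assms(1)] by blast
  then show ?thesis using assms(2,3) by (metis inv_closed inv_equality inv_inv)
qed

context periodic_graph
begin

lemma orbit_act:
  assumes "g \<in> carrier L" "v \<in> verts G"
  shows "orbit L \<alpha> (\<alpha> g v) = orbit L \<alpha> v"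
proof -
  have "\<alpha> g v \<in> verts G" using V.element_image assms by blast
  moreover from this have "\<alpha> g v \<in> orbit L \<alpha> (\<alpha> g v)" by (rule V.orbit_refl)
  moreover have "\<alpha> g v \<in> orbit L \<alpha> v" using assms(1) by (auto simp: orbit_def)
  moreover have "orbit L \<alpha> v \<in> orbits L (verts G) \<alpha>" using assms(2) by (auto simp: orbits_def)
  moreover have "orbit L \<alpha> (\<alpha> g v) \<in> orbits L (verts G) \<alpha>"
    using calculation(1) by (auto simp: orbits_def)
  ultimately show ?thesis using V.disjoint_union by blast
qed

lemma orbit_eqE:
  assumes "orbit L \<alpha> u = orbit L \<alpha> v" "v \<in> verts G"
  obtains g where "g \<in> carrier L" "v = \<alpha> g u"
  using V.orbit_refl[OF assms(2)] assms(1) by (auto simp: orbit_def)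

lemma act_inverse:
  assumes "g \<in> carrier L" "v \<in> verts G"
  shows "\<alpha> g (\<alpha> (inv\<^bsub>L\<^esub> g) v) = v" "\<alpha> (inv\<^bsub>L\<^esub> g) (\<alpha> g v) = v"
  using assms V.orbit_sym_aux[of "inv\<^bsub>L\<^esub> g" v] V.orbit_sym_aux[of g v] by auto

text \<open>Commutativity of \<open>L\<close> makes the displacement of a cycle modulo
  \<open>L\<close> the same at all vertices of an orbit.\<close>

lemma act_commute:
  assumes "g \<in> carrier L" "h \<in> carrier L" "v \<in> verts G"
  shows "\<alpha> g (\<alpha> h v) = \<alpha> h (\<alpha> g v)"
  using assms V.composition_rule[of v g h] V.composition_rule[of v h g] L.m_comm by metis

lemma awalk_translate:
  assumes "g \<in> carrier L" "awalk u p v"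
  shows "awalk (\<alpha> g u) (map (\<beta> g) p) (\<alpha> g v)"
  using assms(2)
proof (induction p arbitrary: u)
  case Nil
  then show ?case using V.element_image[OF assms(1)] by (auto simp: awalk_Nil_iff)
next
  case (Cons e p)
  then show ?case
    using E.element_image[OF assms(1), of e] tail_equivariant[OF assms(1)] head_equivariant[OF assms(1)]
    by (auto simp: awalk_Cons_iff)
qed

lemma weight_translate:
  assumes "g \<in> carrier L" "set p \<subseteq> arcs G"
  shows "sum_list (map w (map (\<beta> g) p)) = sum_list (map w p)"
  using assms(2) by (induction p) (auto simp: weight_invariant[OF assms(1)])

lemma tail_orbits_translate:
  assumes "g \<in> carrier L" "set p \<subseteq> arcs G"
  shows "map (\<lambda>e. orbit L \<alpha> (tail G e)) (map (\<beta> g) p) = map (\<lambda>e. orbit L \<alpha> (tail G e)) p"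
  using assms(2) by (induction p) (auto simp: tail_equivariant[OF assms(1)] orbit_act[OF assms(1)])

text \<open>A vertex is encoded by the number of its orbit and by the group element that carries the
  chosen representative to it, which is unique by freeness. The values lie in a type with
  componentwise addition, where the cancellative monoid laws hold without a carrier.\<close>

lemma ex_vertex_coordinates:
  "\<exists>(code :: 'v \<Rightarrow> nat \<times> (nat \<Rightarrow> int)) \<phi>. inj_on code (verts G) \<and>
     (\<forall>g\<in>carrier L. \<forall>v\<in>verts G. code (\<alpha> g v) = \<phi> g + code v)"
proof -
  obtain n :: nat and h where h: "h \<in> iso L (product_group {..<n} (\<lambda>_. integer_group))"
    using free_abelian_fin_rank by (auto simp: is_iso_def)
  \<comment> \<open>Elements of the product group are \<open>undefined\<close> outside the index
    set; extension by 0 makes the map additive for pointwise addition.\<close>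
  define \<psi> where "\<psi> g = (\<lambda>i. if i < n then h g i else 0)" for g
  have \<psi>_mult: "\<psi> (g \<otimes>\<^bsub>L\<^esub> g') = \<psi> g + \<psi> g'" if "g \<in> carrier L" "g' \<in> carrier L" for g g'
    using that h by (auto simp: \<psi>_def iso_def hom_def)
  have \<psi>_inj: "g = g'" if g: "g \<in> carrier L" "g' \<in> carrier L" "\<psi> g = \<psi> g'" for g g'
  proof -
    have ext: "h g \<in> extensional {..<n}" "h g' \<in> extensional {..<n}"
      using g h by (auto simp: iso_def hom_def PiE_def)
    have "h g = h g'"
    proof (rule extensionalityI[OF ext])
      show "h g i = h g' i" if "i \<in> {..<n}" for i
        using fun_cong[OF g(3), of i] that by (simp add: \<psi>_def)
    qed
    then show ?thesis using g h by (auto simp: iso_def bij_betw_def inj_on_def)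
  qed
  obtain idx :: "'v set \<Rightarrow> nat" where idx: "inj_on idx (orbits L (verts G) \<alpha>)"
    using finite_imp_inj_to_nat_seg[OF finite_vert_orbits] by blast
  define rep where "rep X = (SOME v. v \<in> verts G \<and> orbit L \<alpha> v = X)" for X
  have rep: "rep (orbit L \<alpha> v) \<in> verts G \<and> orbit L \<alpha> (rep (orbit L \<alpha> v)) = orbit L \<alpha> v"
    if "v \<in> verts G" for v
    unfolding rep_def by (rule someI[of _ v]) (use that in simp)
  define elt where "elt v = (SOME g. g \<in> carrier L \<and> v = \<alpha> g (rep (orbit L \<alpha> v)))" for v
  have elt: "elt v \<in> carrier L \<and> v = \<alpha> (elt v) (rep (orbit L \<alpha> v))" if v: "v \<in> verts G" for v
  proof -
    obtain g where "g \<in> carrier L \<and> v = \<alpha> g (rep (orbit L \<alpha> v))"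
      using orbit_eqE[of "rep (orbit L \<alpha> v)" v] rep v by metis
    then show ?thesis unfolding elt_def by (rule someI)
  qed
  define code where "code v = (idx (orbit L \<alpha> v), \<psi> (elt v))" for v
  have "inj_on code (verts G)"
  proof (rule inj_onI)
    fix u v assume uv: "u \<in> verts G" "v \<in> verts G" "code u = code v"
    have "orbit L \<alpha> u \<in> orbits L (verts G) \<alpha>" "orbit L \<alpha> v \<in> orbits L (verts G) \<alpha>"
      using uv by (auto simp: orbits_def)
    then have "orbit L \<alpha> u = orbit L \<alpha> v"
      using inj_onD[OF idx] uv(3) by (simp add: code_def)
    moreover have "elt u = elt v" using \<psi>_inj elt uv by (simp add: code_def)
    ultimately show "u = v" using elt uv(1,2) by metis
  qed
  \<comment> \<open>The first component of the translation is 0 because the action preserves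
    orbits.\<close>
  moreover have "code (\<alpha> g v) = (0, \<psi> g) + code v" if "g \<in> carrier L" "v \<in> verts G" for g v
  proof -
    have gv: "\<alpha> g v \<in> verts G" using V.element_image that by blast
    let ?r = "rep (orbit L \<alpha> v)"
    have "\<alpha> (elt (\<alpha> g v)) ?r = \<alpha> g v" using elt[OF gv] orbit_act[OF that] by simp
    also have "\<dots> = \<alpha> g (\<alpha> (elt v) ?r)" using elt[OF that(2)] by simp
    also have "\<dots> = \<alpha> (g \<otimes>\<^bsub>L\<^esub> elt v) ?r"
      using V.composition_rule rep elt that by simp
    finally have "elt (\<alpha> g v) = g \<otimes>\<^bsub>L\<^esub> elt v"
      using V.free_action_cancel[of ?r] rep[OF that(2)] elt[OF gv] elt[OF that(2)] that(1) by simp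
    then show ?thesis
      using orbit_act[OF that] \<psi>_mult that elt by (simp add: code_def)
  qed
  ultimately show ?thesis by (intro exI[of _ code] exI[of _ "\<lambda>g. (0, \<psi> g)"]) blast
qed

end

section \<open>Walks as elements of finitely generated modules\<close>

locale coordinatized_periodic_graph = periodic_graph G w L \<alpha> \<beta>
  for G :: "('v, 'e) pre_digraph" (structure)
    and w :: "'e \<Rightarrow> nat"
    and L :: "'l monoid"
    and \<alpha> :: "'l \<Rightarrow> 'v \<Rightarrow> 'v"
    and \<beta> :: "'l \<Rightarrow> 'e \<Rightarrow> 'e" +
  fixes code :: "'v \<Rightarrow> 'g::cancel_comm_monoid_add"
    and shift :: "'l \<Rightarrow> 'g"
  assumes code_inj: "inj_on code (verts G)"
    and code_act: "\<lbrakk>g \<in> carrier L; v \<in> verts G\<rbrakk> \<Longrightarrow> code (\<alpha> g v) = shift g + code v"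
begin

definition weight :: "'e list \<Rightarrow> nat" where
  "weight p = sum_list (map w p)"

definition tail_orbits :: "'e list \<Rightarrow> 'v set list" where
  "tail_orbits p = map (\<lambda>e. orbit L \<alpha> (tail G e)) p"

definition orbit_number :: nat where
  "orbit_number = card (orbits L (verts G) \<alpha>)"

text \<open>Cycles modulo \<open>L\<close>, recorded by displacement and weight. The length bound is
  that of a removable loop \<open>v # bs\<close>. Only the starting orbit has to lie in
  \<open>T\<close>, which suffices for inserting the cycle into a walk that visits
  \<open>T\<close>.\<close>

definition cycle_generators :: "'v set set \<Rightarrow> ('g \<times> nat) set" where
  "cycle_generators T = {(shift g, weight q) | g v q. g \<in> carrier L \<and> v \<in> verts G \<and>
     orbit L \<alpha> v \<in> T \<and> awalk v q (\<alpha> g v) \<and> q \<noteq> [] \<and> length q \<le> Suc orbit_number}"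

text \<open>The generator \<open>(0, 1)\<close> turns ``weight equal to i'' into ``weight at most i''.\<close>

definition generators :: "'v set set \<Rightarrow> ('g \<times> nat) set" where
  "generators T = insert (0, 1) (cycle_generators T)"

text \<open>The length bound is the threshold beyond which a walk has a removable loop, with the
  number of vertex orbits bounding the alphabet.\<close>

definition short_walks :: "'v set \<Rightarrow> 'v set set \<Rightarrow> ('g \<times> nat) set" where
  "short_walks U T = {(code y, weight p) | x p y. x \<in> U \<and> awalk x p y \<and>
     length p \<le> Suc orbit_number * orbit_number \<and> set (tail_orbits p) = T}"

lemma weight_append [simp]: "weight (p @ q) = weight p + weight q"
  by (simp add: weight_def)

lemma tail_orbits_append [simp]: "tail_orbits (p @ q) = tail_orbits p @ tail_orbits q"
  by (simp add: tail_orbits_def)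

lemma weight_act: "g \<in> carrier L \<Longrightarrow> set p \<subseteq> arcs G \<Longrightarrow> weight (map (\<beta> g) p) = weight p"
  unfolding weight_def by (rule weight_translate)

lemma tail_orbits_act:
  "g \<in> carrier L \<Longrightarrow> set p \<subseteq> arcs G \<Longrightarrow> tail_orbits (map (\<beta> g) p) = tail_orbits p"
  unfolding tail_orbits_def by (rule tail_orbits_translate)

lemma awalk_arcs: "awalk u p v \<Longrightarrow> set p \<subseteq> arcs G"
  by (auto simp: awalk_def)

lemma tail_orbits_subset:
  "awalk u p v \<Longrightarrow> set (tail_orbits p) \<subseteq> orbits L (verts G) \<alpha>"
  using awalk_arcs[of u p v] by (fastforce simp: tail_orbits_def orbits_def)

lemma weight_pos_if_nonempty:
  assumes "awalk u p v" "p \<noteq> []"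
  shows "0 < weight p"
proof -
  obtain e q where "p = e # q" using assms(2) by (cases p) auto
  then show ?thesis using assms(1) weight_pos[of e] by (simp add: weight_def awalk_Cons_iff)
qed

text \<open>Translating a cycle changes neither its displacement nor its weight, so it may start at
  one of finitely many orbit representatives.\<close>

lemma finite_cycle_generators: "finite (cycle_generators T)"
proof -
  have "orbits L (verts G) \<alpha> \<subseteq> orbit L \<alpha> ` verts G" by (auto simp: orbits_def)
  from finite_subset_image[OF finite_vert_orbits this]
  obtain R where R: "R \<subseteq> verts G" "finite R" "orbits L (verts G) \<alpha> = orbit L \<alpha> ` R"
    by (elim exE conjE)
  \<comment> \<open>The displacement is recovered from the two ends of the walk; it is unique by
    cancellation.\<close>
  let ?f = "\<lambda>(v, q). (THE d. code (awlast v q) = d + code v, weight q)"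
  have "cycle_generators T \<subseteq> ?f ` (SIGMA v:R. {q. (\<exists>y. awalk v q y) \<and> length q \<le> Suc orbit_number})"
  proof
    fix z assume "z \<in> cycle_generators T"
    then obtain g v q where q: "z = (shift g, weight q)" "g \<in> carrier L" "v \<in> verts G"
        "awalk v q (\<alpha> g v)" "length q \<le> Suc orbit_number"
      by (auto simp: cycle_generators_def)
    obtain r where r: "r \<in> R" "orbit L \<alpha> v = orbit L \<alpha> r"
      using R(3) q(3) unfolding orbits_def by blast
    then obtain k where k: "k \<in> carrier L" "r = \<alpha> k v"
      using orbit_eqE[of v r] R(1) by blast
    let ?q = "map (\<beta> k) q"
    have "awalk r ?q (\<alpha> k (\<alpha> g v))" using awalk_translate[OF k(1) q(4)] k(2) by simp
    then have walk: "awalk r ?q (\<alpha> g r)" using act_commute[OF k(1) q(2,3)] k(2) by simp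
    then have last: "awlast r ?q = \<alpha> g r" by simp
    have "code (\<alpha> g r) = shift g + code r" using code_act q(2) r(1) R(1) by blast
    then have "(THE d. code (awlast r ?q) = d + code r) = shift g" unfolding last by simp
    then have "?f (r, ?q) = z" using weight_act[OF k(1) awalk_arcs[OF q(4)]] q(1) by simp
    then show "z \<in> ?f ` (SIGMA v:R. {q. (\<exists>y. awalk v q y) \<and> length q \<le> Suc orbit_number})"
      using r(1) walk q(5) by (intro image_eqI[of _ _ "(r, ?q)"]) auto
  qed
  then show ?thesis
    by (rule finite_subset) (intro finite_imageI finite_SigmaI R(2) finite_awalks_from)
qed

lemma finite_short_walks:
  assumes "finite U"
  shows "finite (short_walks U T)"
proof -
  let ?K = "Suc orbit_number * orbit_number"
  have "short_walks U T \<subseteq> (\<lambda>(x, p). (code (awlast x p), weight p)) `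
      (SIGMA x:U. {p. (\<exists>y. awalk x p y) \<and> length p \<le> ?K})"
  proof
    fix z assume "z \<in> short_walks U T"
    then obtain x p y where p: "z = (code y, weight p)" "x \<in> U" "awalk x p y" "length p \<le> ?K"
      unfolding short_walks_def by blast
    then have "z = (\<lambda>(x, p). (code (awlast x p), weight p)) (x, p)" by simp
    then show "z \<in> (\<lambda>(x, p). (code (awlast x p), weight p)) `
        (SIGMA x:U. {p. (\<exists>y. awalk x p y) \<and> length p \<le> ?K})"
      using p(2-4) by (intro image_eqI[of _ _ "(x, p)"]) auto
  qed
  then show ?thesis
    by (rule finite_subset) (intro finite_imageI finite_SigmaI assms finite_awalks_from)
qed

lemma generators_pos: "z \<in> generators T \<Longrightarrow> 0 < snd z"
  using weight_pos_if_nonempty by (auto simp: generators_def cycle_generators_def)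

text \<open>Strong induction on the length. A long walk has a removable loop in its word of tail
  orbits; the loop is cut out and the remainder translated back to close the gap. The shorter walk
  visits the same orbits, and the two pairs differ by a cycle generator.\<close>

lemma walk_in_fg_module:
  assumes "x \<in> U" "awalk x p y"
  shows "(code y, weight p) \<in> fg_module (short_walks U (set (tail_orbits p))) (generators (set (tail_orbits p)))"
  using assms(2)
proof (induction "length p" arbitrary: p y rule: less_induct)
  case less
  let ?T = "set (tail_orbits p)"
  show ?case
  proof (cases "length p \<le> Suc orbit_number * orbit_number")
    case True
    then have "(code y, weight p) \<in> short_walks U ?T"
      using assms(1) less.prems unfolding short_walks_def by blast
    from fg_moduleI[OF this zero_in_nat_span] show ?thesis by simp
  next
    case False
    have "card ?T \<le> orbit_number"
      unfolding orbit_number_def by (rule card_mono[OF finite_vert_orbits tail_orbits_subset[OF less.prems]])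
    moreover from this have "Suc orbit_number * card ?T \<le> Suc orbit_number * orbit_number"
      by (rule mult_le_mono2)
    then have "Suc orbit_number * card ?T < length (tail_orbits p)"
      using False by (simp add: tail_orbits_def)
    ultimately obtain as v bs ds where cut: "tail_orbits p = as @ (v # bs) @ (v # ds)"
        "set bs \<subseteq> set as \<union> set (v # ds)" "length bs \<le> orbit_number"
      using ex_removable_loop by blast
    have split: "\<exists>q r. p = q @ r \<and> tail_orbits q = xs \<and> tail_orbits r = ys"
      if "tail_orbits p = xs @ ys" for p xs ys
      using that by (auto simp: tail_orbits_def map_eq_append_conv)
    obtain p1 r1 where r1: "p = p1 @ r1" "tail_orbits p1 = as"
        "tail_orbits r1 = (v # bs) @ (v # ds)"
      using split[OF cut(1)] by (elim exE conjE)
    obtain r2 r3 where r2: "r1 = r2 @ r3" "tail_orbits r2 = v # bs" "tail_orbits r3 = v # ds"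
      using split[OF r1(3)] by (elim exE conjE)
    obtain e p2 where e: "r2 = e # p2" "orbit L \<alpha> (tail G e) = v" "tail_orbits p2 = bs"
      using r2(2) by (cases r2) (auto simp: tail_orbits_def)
    obtain f p3 where f: "r3 = f # p3" "orbit L \<alpha> (tail G f) = v" "tail_orbits p3 = ds"
      using r2(3) by (cases r3) (auto simp: tail_orbits_def)
    note p = r1(1)[unfolded r2(1) e(1) f(1)] r1(2) e(2,3) f(2,3)
    have walks: "awalk x p1 (tail G e)" "awalk (tail G e) (e # p2) (tail G f)"
        "awalk (tail G f) (f # p3) y"
      using less.prems unfolding p(1) by (auto simp: awalk_Cons_iff)
    have verts: "tail G e \<in> verts G" "tail G f \<in> verts G" "y \<in> verts G"
      using walks by auto
    obtain g where g: "g \<in> carrier L" "tail G f = \<alpha> g (tail G e)"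
      using orbit_eqE[of "tail G e" "tail G f"] p(3,5) verts(2) by metis
    define g' where "g' = inv\<^bsub>L\<^esub> g"
    have g': "g' \<in> carrier L" using g(1) by (simp add: g'_def)
    have returns: "\<alpha> g' (tail G f) = tail G e" using act_inverse(2)[OF g(1) verts(1)] g(2) g'_def by simp
    define p' where "p' = p1 @ map (\<beta> g') (f # p3)"
    have walk': "awalk x p' (\<alpha> g' y)"
      unfolding p'_def using awalk_appendI[OF walks(1)] awalk_translate[OF g' walks(3)] returns by metis
    have "tail_orbits p' = as @ v # ds"
      using p(2,5,6) tail_orbits_act[OF g' awalk_arcs[OF walks(3)]]
      unfolding p'_def by (simp add: tail_orbits_def)
    \<comment> \<open>The letters of \<open>bs\<close> also occur in \<open>as\<close> or in
      \<open>v # ds\<close>, and \<open>v\<close> itself remains.\<close>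
    then have T: "set (tail_orbits p') = ?T" using cut(1,2) by auto
    have "length p' < length p" by (simp add: p'_def p(1))
    from less.hyps[OF this walk']
    have IH: "(code (\<alpha> g' y), weight p') \<in> fg_module (short_walks U ?T) (generators ?T)"
      unfolding T .
    have "v \<in> ?T" using cut(1) by simp
    moreover have "length (e # p2) \<le> Suc orbit_number" using cut(3) p(4) by (auto simp: tail_orbits_def)
    ultimately have "(shift g, weight (e # p2)) \<in> cycle_generators ?T"
      unfolding cycle_generators_def mem_Collect_eq
      by (intro exI[of _ g] exI[of _ "tail G e"] exI[of _ "e # p2"])
        (use g walks(2) verts(1) p(3) in simp)
    then have gen: "(shift g, weight (e # p2)) \<in> nat_span (generators ?T)"
      by (intro generator_in_nat_span) (simp add: generators_def)
    have "code y = shift g + code (\<alpha> g' y)"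
      using code_act[OF g(1) V.element_image[OF g' verts(3) refl]] act_inverse(1)[OF g(1) verts(3)]
      by (simp add: g'_def)
    moreover have "weight p = weight p' + weight (e # p2)"
      using weight_act[OF g' awalk_arcs[OF walks(3)]] unfolding p(1) p'_def weight_append by simp
    ultimately have "(code y, weight p) = (code (\<alpha> g' y), weight p') + (shift g, weight (e # p2))"
      by (simp add: add.commute)
    then show ?thesis using fg_module_add[OF IH gen] by simp
  qed
qed

text \<open>Starting from a short walk, each cycle generator is inserted where the walk visits its
  orbit, while \<open>(0, 1)\<close> only raises the degree; hence the inequality for the weight. An
  inserted cycle may meet further orbits, hence the inclusion for \<open>T\<close>.\<close>

lemma fg_module_in_ball:
  assumes "z \<in> fg_module (short_walks U T) (generators T)"
  shows "\<exists>x\<in>U. \<exists>p y. awalk x p y \<and> fst z = code y \<and> weight p \<le> snd z \<and> T \<subseteq> set (tail_orbits p)"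
proof -
  obtain b c where bc: "b \<in> short_walks U T" "set_mset c \<subseteq> generators T" "z = b + sum_mset c"
    using assms unfolding fg_module_def nat_span_def by blast
  have "\<exists>x\<in>U. \<exists>p y. awalk x p y \<and> fst (b + sum_mset c) = code y \<and>
      weight p \<le> snd (b + sum_mset c) \<and> T \<subseteq> set (tail_orbits p)"
    using bc(2)
  proof (induction c)
    case empty
    obtain x p y where "b = (code y, weight p)" "x \<in> U" "awalk x p y" "set (tail_orbits p) = T"
      using bc(1) unfolding short_walks_def by blast
    then show ?case by (intro bexI[of _ x] exI[of _ p] exI[of _ y]) auto
  next
    case (add s c)
    let ?z = "b + sum_mset c"
    have sum: "b + sum_mset (add_mset s c) = s + ?z" by (simp add: ac_simps)
    obtain x p y where p: "x \<in> U" "awalk x p y" "fst ?z = code y" "weight p \<le> snd ?z"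
        "T \<subseteq> set (tail_orbits p)"
      using add by auto
    have "s = (0, 1) \<or> s \<in> cycle_generators T" using add.prems by (auto simp: generators_def)
    then show ?case
    proof
      assume "s = (0, 1)"
      then show ?thesis using p unfolding sum by (intro bexI[of _ x] exI[of _ p] exI[of _ y]) auto
    next
      assume "s \<in> cycle_generators T"
      then obtain g v q where q: "s = (shift g, weight q)" "g \<in> carrier L" "v \<in> verts G"
          "orbit L \<alpha> v \<in> T" "awalk v q (\<alpha> g v)"
        unfolding cycle_generators_def by blast
      have "orbit L \<alpha> v \<in> set (tail_orbits p)" using p(5) q(4) by blast
      then obtain e where e: "e \<in> set p" "orbit L \<alpha> v = orbit L \<alpha> (tail G e)"
        by (auto simp: tail_orbits_def)
      then obtain p1 p2 where p12: "p = p1 @ e # p2" using split_list by metis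
      have walks: "awalk x p1 (tail G e)" "awalk (tail G e) (e # p2) y"
        using p(2) unfolding p12 by (auto simp: awalk_Cons_iff)
      have verts: "tail G e \<in> verts G" "y \<in> verts G" using walks by auto
      obtain k where k: "k \<in> carrier L" "tail G e = \<alpha> k v"
        using orbit_eqE[OF e(2) verts(1)] by blast
      have "awalk (tail G e) (map (\<beta> k) q) (\<alpha> k (\<alpha> g v))"
        using awalk_translate[OF k(1) q(5)] k(2) by simp
      \<comment> \<open>By commutativity the translated cycle still has displacement
        \<open>g\<close>, so the rest of the walk is translated by \<open>g\<close>.\<close>
      then have "awalk (tail G e) (map (\<beta> k) q) (\<alpha> g (tail G e))"
        using act_commute[OF k(1) q(2,3)] k(2) by simp
      from awalk_appendI[OF walks(1) awalk_appendI[OF this awalk_translate[OF q(2) walks(2)]]]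
      have walk: "awalk x (p1 @ map (\<beta> k) q @ map (\<beta> g) (e # p2)) (\<alpha> g y)" .
      have "weight (map (\<beta> g) (e # p2)) = weight (e # p2)"
        "tail_orbits (map (\<beta> g) (e # p2)) = tail_orbits (e # p2)"
        using weight_act tail_orbits_act q(2) awalk_arcs[OF walks(2)] by blast+
      moreover have "weight (map (\<beta> k) q) = weight q"
        by (rule weight_act[OF k(1) awalk_arcs[OF q(5)]])
      ultimately have "weight (p1 @ map (\<beta> k) q @ map (\<beta> g) (e # p2)) = weight q + weight p"
        "set (tail_orbits p) \<subseteq> set (tail_orbits (p1 @ map (\<beta> k) q @ map (\<beta> g) (e # p2)))"
        by (auto simp: p12 simp del: list.map)
      moreover have "fst (s + ?z) = code (\<alpha> g y)"
        using p(3) q(1) code_act[OF q(2) verts(2)] by simp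
      moreover have "snd (s + ?z) = weight q + snd ?z" using q(1) by simp
      ultimately show ?thesis using walk p(1,4,5) unfolding sum
        by (intro bexI[of _ x] exI[of _ "p1 @ map (\<beta> k) q @ map (\<beta> g) (e # p2)"] exI[of _ "\<alpha> g y"])
          auto
    qed
  qed
  then show ?thesis unfolding bc(3) .
qed

lemma ball_eq_Union_fg_module:
  "{(code y, i) | x p y i. x \<in> U \<and> awalk x p y \<and> weight p \<le> i}
    = (\<Union>T\<in>Pow (orbits L (verts G) \<alpha>). fg_module (short_walks U T) (generators T))"
proof (intro equalityI subsetI)
  fix z assume "z \<in> {(code y, i) | x p y i. x \<in> U \<and> awalk x p y \<and> weight p \<le> i}"
  then obtain x p y i where z: "z = (code y, i)" "x \<in> U" "awalk x p y" "weight p \<le> i" by blast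
  \<comment> \<open>The difference between the degree and the weight of the walk is made up by
    copies of \<open>(0, 1)\<close>.\<close>
  have slack: "(0, n) \<in> nat_span (generators T)" for n T
  proof (induction n)
    case 0
    show ?case using zero_in_nat_span[of "generators T"] by (simp add: zero_prod_def)
  next
    case (Suc n)
    have "(0, 1) \<in> nat_span (generators T)"
      by (rule generator_in_nat_span) (simp add: generators_def)
    from add_in_nat_span[OF Suc this] show ?case by simp
  qed
  have "z = (code y, weight p) + (0, i - weight p)" using z(1,4) by simp
  then have "z \<in> fg_module (short_walks U (set (tail_orbits p))) (generators (set (tail_orbits p)))"
    using fg_module_add[OF walk_in_fg_module[OF z(2,3)] slack] by simp
  then show "z \<in> (\<Union>T\<in>Pow (orbits L (verts G) \<alpha>). fg_module (short_walks U T) (generators T))"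
    using tail_orbits_subset[OF z(3)] by blast
next
  fix z assume "z \<in> (\<Union>T\<in>Pow (orbits L (verts G) \<alpha>). fg_module (short_walks U T) (generators T))"
  then obtain T where "z \<in> fg_module (short_walks U T) (generators T)" by blast
  from fg_module_in_ball[OF this]
  obtain x p y where "x \<in> U" "awalk x p y" "fst z = code y" "weight p \<le> snd z" by blast
  then show "z \<in> {(code y, i) | x p y i. x \<in> U \<and> awalk x p y \<and> weight p \<le> i}"
    by (cases z) auto
qed

lemma eventually_quasi_poly_ball_card:
  assumes "finite U"
  shows "eventually_quasi_poly (\<lambda>i. of_nat (card {y \<in> verts G. (INF x\<in>U. wdist G w x y) \<le> enat i})
    :: 'b::field_char_0)"
proof -
  interpret graded_monoid "snd :: 'g \<times> nat \<Rightarrow> nat" by unfold_locales simp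
  let ?X = "\<lambda>T. fg_module (short_walks U T) (generators T)"
  let ?S = "{(code y, i) | x p y i. x \<in> U \<and> awalk x p y \<and> weight p \<le> i}"
  have "finite (?X ` Pow (orbits L (verts G) \<alpha>))"
    by (intro finite_imageI) (simp add: finite_vert_orbits)
  then obtain Xs where Xs: "set Xs = ?X ` Pow (orbits L (verts G) \<alpha>)" using finite_list by metis
  have fg: "fg (?X T)" for T
    unfolding fg_def using finite_short_walks[OF assms] finite_cycle_generators generators_pos
    by (intro exI[of _ "short_walks U T"] exI[of _ "generators T"]) (auto simp: generators_def)
  have "eventually_quasi_poly (\<lambda>i. of_nat (card {x \<in> \<Union>(set Xs). snd x = i}) :: 'b)"
    by (rule eventually_quasi_poly_fg_Union_count) (use Xs fg in auto)
  moreover have "\<Union>(set Xs) = ?S" unfolding Xs ball_eq_Union_fg_module ..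
  moreover have "card {z \<in> ?S. snd z = i} = card {y \<in> verts G. (INF x\<in>U. wdist G w x y) \<le> enat i}" for i
  proof -
    have dist: "(INF x\<in>U. wdist G w x y) \<le> enat i \<longleftrightarrow> (\<exists>x\<in>U. \<exists>p. awalk x p y \<and> weight p \<le> i)" for y
    proof -
      \<comment> \<open>A strict bound on an infimum is met by some member, also in the form needed
        for an empty \<open>U\<close>, whose infimum is \<infinity>.\<close>
      have less_Suc: "d \<le> enat i \<longleftrightarrow> d < enat (Suc i)" for d by (cases d) auto
      have "(INF x\<in>U. wdist G w x y) \<le> enat i \<longleftrightarrow> (\<exists>x\<in>U. wdist G w x y \<le> enat i)"
        unfolding less_Suc by (simp add: INF_less_iff)
      then show ?thesis unfolding wdist_le_iff weight_def .
    qed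
    have "{z \<in> ?S. snd z = i} = (\<lambda>y. (code y, i)) ` {y \<in> verts G. (INF x\<in>U. wdist G w x y) \<le> enat i}"
      (is "?lhs = ?rhs")
    proof (intro equalityI subsetI)
      fix z assume "z \<in> ?lhs"
      then obtain x p y where z: "z = (code y, i)" "x \<in> U" "awalk x p y" "weight p \<le> i" by auto
      then have "y \<in> {y \<in> verts G. (INF x\<in>U. wdist G w x y) \<le> enat i}" unfolding dist by auto
      then show "z \<in> ?rhs" using z(1) by blast
    next
      fix z assume "z \<in> ?rhs"
      then show "z \<in> ?lhs" unfolding dist by auto
    qed
    moreover have "inj_on (\<lambda>y. (code y, i)) {y \<in> verts G. (INF x\<in>U. wdist G w x y) \<le> enat i}"
      using code_inj by (auto simp: inj_on_def)
    ultimately show ?thesis by (simp add: card_image)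
  qed
  ultimately show ?thesis by simp
qed

end

theorem theoremA4:
  fixes G :: "('v, 'e) pre_digraph"
    and w :: "'e \<Rightarrow> nat"
    and L :: "'l monoid"
    and \<alpha> :: "'l \<Rightarrow> 'v \<Rightarrow> 'v"
    and \<beta> :: "'l \<Rightarrow> 'e \<Rightarrow> 'e"
    and U :: "'v set"
  assumes "periodic_graph G w L \<alpha> \<beta>"
    and "U \<subseteq> verts G"
    and "finite U"
  shows "quasi_polynomial_type
    (\<lambda>i. of_nat (card {y \<in> verts G. (INF x\<in>U. wdist G w x y) \<le> enat i}))"
proof -
  interpret periodic_graph G w L \<alpha> \<beta> by fact
  obtain code :: "'v \<Rightarrow> nat \<times> (nat \<Rightarrow> int)" and \<phi> where code: "inj_on code (verts G)"
      "\<forall>g\<in>carrier L. \<forall>v\<in>verts G. code (\<alpha> g v) = \<phi> g + code v"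
    using ex_vertex_coordinates by (elim exE conjE)
  interpret coordinatized_periodic_graph G w L \<alpha> \<beta> code \<phi>
    by unfold_locales (use code in auto)
  show ?thesis
    by (rule quasi_polynomial_type_if_eventually_quasi_poly[OF eventually_quasi_poly_ball_card[OF assms(3)]])
qed

end
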